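(* Let $x$ be a fixed-point-free involution in $S_{2n}$. Then $\hat{\mathcal{R}}(w_{\mathrm{fpf}},x)$ is an equivalence class under the equivalence relation on finite words in $\{s_1,\dots,s_{2n-1}\}$ generated by the relations $(s_{2i},s_{2i-1},\dots)\sim(s_{2i},s_{2i+1},\dots)$ for $i\in[n-1]$ (where the two words agree after their first two letters) together with the braid relations for $S_{2n}$.
   Context: $S_{2n}$ has simple generators $s_i=(i,i+1)$ and length $\ell$. The Demazure product $\circ$ is the unique associative operation on $S_{2n}$ with $s\circ w = sw$ if $\ell(sw)>\ell(w)$ and $s\circ w=w$ otherwise, and $w\circ s=ws$ if $\ell(ws)>\ell(w)$ and $w\circ s = w$ otherwise. Let $w_{\mathrm{fpf}}=s_1s_3\cdots s_{2n-1}$. For involutions $x,y$, $\hat{\mathcal{R}}(x,y)$ is the set of sequences $(t_1,\dots,t_k)$ of simple generators of shortest possible length $k$ with $(t_1\circ\cdots\circ t_k)^{-1}\circ x\circ(t_1\circ\cdots\circ t_k)=y$. The braid relations for $S_{2n}$ are $(\dots,s_i,s_{i+1},s_i,\dots)\sim(\dots,s_{i+1},s_i,s_{i+1},\dots)$ and $(\dots,s_i,s_j,\dots)\sim(\dots,s_j,s_i,\dots)$ for $|i-j|>1$, applied at any position with all other letters equal. *)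

theory Defs
  imports "HOL-Combinatorics.Permutations"
begin

text \<open>
  The symmetric group \<open>S_N\<close> is the set of permutations of \<open>{1..N}\<close>, as functions on \<open>nat\<close> that fix
  everything else; the group product is composition.  The simple generator \<open>s_i\<close> is represented by
  its index \<open>i \<in> {1..<N}\<close>, so that words in the generators are lists of indices.
\<close>

definition Sym :: "nat \<Rightarrow> (nat \<Rightarrow> nat) set" where
  "Sym N = {w. w permutes {1..N}}"

definition simple :: "nat \<Rightarrow> nat \<Rightarrow> nat" where
  "simple i = transpose i (Suc i)"

definition words :: "nat \<Rightarrow> nat list set" where
  "words N = lists {1..<N}"

definition word_prod :: "nat list \<Rightarrow> nat \<Rightarrow> nat" where
  "word_prod ts = foldr (\<lambda>i w. simple i \<circ> w) ts id"

definition len :: "nat \<Rightarrow> (nat \<Rightarrow> nat) \<Rightarrow> nat" where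
  "len N w = (LEAST k. \<exists>ts \<in> words N. length ts = k \<and> word_prod ts = w)"

text \<open>
  The identity permutation is required to be a unit.  This follows from the other conditions
  unless \<open>N = 2\<close>: there the operation on \<open>S_2\<close> that is constantly \<open>s_1\<close> satisfies all of them.
\<close>

definition is_demazure :: "nat \<Rightarrow> ((nat \<Rightarrow> nat) \<Rightarrow> (nat \<Rightarrow> nat) \<Rightarrow> (nat \<Rightarrow> nat)) \<Rightarrow> bool" where
  "is_demazure N op \<longleftrightarrow>
     (\<forall>u \<in> Sym N. \<forall>v \<in> Sym N. op u v \<in> Sym N) \<and>
     (\<forall>u \<in> Sym N. \<forall>v \<in> Sym N. \<forall>w \<in> Sym N. op (op u v) w = op u (op v w)) \<and>
     (\<forall>w \<in> Sym N. op id w = w \<and> op w id = w) \<and>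
     (\<forall>i \<in> {1..<N}. \<forall>w \<in> Sym N.
        op (simple i) w =
          (if len N (simple i \<circ> w) > len N w then simple i \<circ> w else w)) \<and>
     (\<forall>i \<in> {1..<N}. \<forall>w \<in> Sym N.
        op w (simple i) =
          (if len N (w \<circ> simple i) > len N w then w \<circ> simple i else w))"

text \<open>
  The last conjunct pins down the irrelevant values outside \<open>S_N\<close>, so that the description is
  definite; see \<open>ex1_demazure\<close> below.
\<close>

definition demazure :: "nat \<Rightarrow> (nat \<Rightarrow> nat) \<Rightarrow> (nat \<Rightarrow> nat) \<Rightarrow> (nat \<Rightarrow> nat)" where
  "demazure N = (THE op. is_demazure N op \<and>
     (\<forall>u v. \<not> (u \<in> Sym N \<and> v \<in> Sym N) \<longrightarrow> op u v = id))"

definition demazure_word :: "nat \<Rightarrow> nat list \<Rightarrow> (nat \<Rightarrow> nat)" where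
  "demazure_word N ts = foldr (\<lambda>i w. demazure N (simple i) w) ts id"

definition demazure_conj :: "nat \<Rightarrow> (nat \<Rightarrow> nat) \<Rightarrow> nat list \<Rightarrow> (nat \<Rightarrow> nat)" where
  "demazure_conj N x ts =
     demazure N (demazure N (inv (demazure_word N ts)) x) (demazure_word N ts)"

definition inv_words :: "nat \<Rightarrow> (nat \<Rightarrow> nat) \<Rightarrow> (nat \<Rightarrow> nat) \<Rightarrow> nat list set" where
  "inv_words N x y = {ts \<in> words N. demazure_conj N x ts = y \<and>
     (\<forall>us \<in> words N. demazure_conj N x us = y \<longrightarrow> length ts \<le> length us)}"

definition fpf_involution :: "nat \<Rightarrow> (nat \<Rightarrow> nat) \<Rightarrow> bool" where
  "fpf_involution N x \<longleftrightarrow> x \<in> Sym N \<and> x \<circ> x = id \<and> (\<forall>i \<in> {1..N}. x i \<noteq> i)"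

definition w_fpf :: "nat \<Rightarrow> nat \<Rightarrow> nat" where
  "w_fpf n = word_prod (map (\<lambda>j. 2 * j + 1) [0..<n])"

inductive braid :: "nat \<Rightarrow> nat list \<Rightarrow> nat list \<Rightarrow> bool" for N where
  long: "\<lbrakk>us \<in> words N; vs \<in> words N; 1 \<le> i; Suc i < N\<rbrakk> \<Longrightarrow>
    braid N (us @ [i, Suc i, i] @ vs) (us @ [Suc i, i, Suc i] @ vs)"
| comm: "\<lbrakk>us \<in> words N; vs \<in> words N; i \<in> {1..<N}; j \<in> {1..<N}; \<bar>int i - int j\<bar> > 1\<rbrakk> \<Longrightarrow>
    braid N (us @ [i, j] @ vs) (us @ [j, i] @ vs)"

inductive initial_rel :: "nat \<Rightarrow> nat list \<Rightarrow> nat list \<Rightarrow> bool" for n where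
  "\<lbrakk>vs \<in> words (2 * n); 1 \<le> i; i \<le> n - 1\<rbrakk> \<Longrightarrow>
    initial_rel n ([2 * i, 2 * i - 1] @ vs) ([2 * i, 2 * i + 1] @ vs)"

text \<open>The equivalence relation on \<open>words (2 * n)\<close> generated by both kinds of relations.\<close>

definition fpf_braid_equiv :: "nat \<Rightarrow> (nat list \<times> nat list) set" where
  "fpf_braid_equiv n = {(us, vs). us \<in> words (2 * n) \<and> vs \<in> words (2 * n) \<and>
     equivclp (\<lambda>a b. braid (2 * n) a b \<or> initial_rel n a b) us vs}"


text \<open>
  Existence and uniqueness of the Demazure product.  Existence: the left and right steps commute, so
  a product of left steps is determined by its value at the identity.
\<close>

lemma words_simps [simp]:
  "[] \<in> words N" "i # ts \<in> words N \<longleftrightarrow> i \<in> {1..<N} \<and> ts \<in> words N"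
  "ts @ us \<in> words N \<longleftrightarrow> ts \<in> words N \<and> us \<in> words N" "rev ts \<in> words N \<longleftrightarrow> ts \<in> words N"
  by (auto simp: words_def)

lemma word_prod_simps [simp]:
  "word_prod [] = id" "word_prod (i # ts) = simple i \<circ> word_prod ts"
  by (auto simp: word_prod_def)

lemma word_prod_append [simp]: "word_prod (ts @ us) = word_prod ts \<circ> word_prod us"
  by (induction ts) (auto simp: comp_assoc)

lemma simple_simple [simp]: "simple i \<circ> simple i = id" "simple i (simple i a) = a"
  by (auto simp: simple_def fun_eq_iff transpose_def)

lemma simple_comp_cancel [simp]:
  "simple i \<circ> (simple i \<circ> w) = w" "(w \<circ> simple i) \<circ> simple i = w"
  by (auto simp: fun_eq_iff)

lemma simple_Sym: "i \<in> {1..<N} \<Longrightarrow> simple i \<in> Sym N"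
  unfolding Sym_def simple_def by (auto intro: permutes_swap_id)

lemma id_Sym [simp]: "id \<in> Sym N"
  by (auto simp: Sym_def permutes_id)

lemma Sym_comp: "u \<in> Sym N \<Longrightarrow> v \<in> Sym N \<Longrightarrow> u \<circ> v \<in> Sym N"
  by (auto simp: Sym_def permutes_compose)

lemma Sym_inv: "u \<in> Sym N \<Longrightarrow> inv u \<in> Sym N"
  by (auto simp: Sym_def permutes_inv)

lemma Sym_bij: "u \<in> Sym N \<Longrightarrow> bij u"
  by (auto simp: Sym_def permutes_bij)

lemma word_prod_Sym: "ts \<in> words N \<Longrightarrow> word_prod ts \<in> Sym N"
  by (induction ts) (auto intro!: Sym_comp simple_Sym)

lemma inv_simple: "inv (simple i) = simple i"
  by (auto simp: simple_def)

lemma bij_simple: "bij (simple i)"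
  by (auto simp: simple_def)

lemma bij_word_prod: "bij (word_prod ts)"
proof (induction ts)
  case (Cons i ts)
  show ?case unfolding word_prod_simps using bij_comp[OF Cons bij_simple] .
qed (simp add: bij_id[unfolded id_def])

lemma inv_word_prod: "inv (word_prod ts) = word_prod (rev ts)"
proof (induction ts)
  case (Cons i ts)
  show ?case
    unfolding word_prod_simps rev.simps word_prod_append comp_id
      o_inv_distrib[OF bij_simple bij_word_prod] inv_simple Cons ..
qed simp

lemma word_transpose:
  assumes "1 \<le> a" "a < b" "b \<le> N"
  shows "\<exists>ts \<in> words N. word_prod ts = transpose a b"
  using assms
proof (induction b)
  case (Suc b)
  show ?case
  proof (cases "a = b")
    case True
    then show ?thesis using Suc by (intro bexI[of _ "[a]"]) (auto simp: simple_def)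
  next
    case False
    then obtain ts where "ts \<in> words N" "word_prod ts = transpose a b" using Suc by auto
    moreover have "simple b \<circ> (transpose a b \<circ> simple b) = transpose a (Suc b)"
      using False Suc.prems by (auto simp: simple_def fun_eq_iff transpose_def)
    ultimately show ?thesis using Suc.prems
      by (intro bexI[of _ "[b] @ ts @ [b]"]) auto
  qed
qed auto

lemma word_exists:
  assumes "w \<in> Sym N" shows "\<exists>ts \<in> words N. word_prod ts = w"
proof -
  have "finite {1..N}" "w permutes {1..N}" using assms by (auto simp: Sym_def)
  then show ?thesis
  proof (induction rule: permutes_rev_induct)
    case id then show ?case by (intro bexI[of _ "[]"]) auto
  next
    case (swap a b p)
    then obtain us where us: "us \<in> words N" "word_prod us = p" by auto
    show ?case
    proof (cases "a = b")
      case True then show ?thesis using us by auto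
    next
      case False
      obtain ts where "ts \<in> words N" "word_prod ts = transpose a b"
        using word_transpose[of a b N] word_transpose[of b a N] swap False
        by (metis atLeastAtMost_iff linorder_neqE_nat transpose_commute)
      then show ?thesis using us by (intro bexI[of _ "us @ ts"]) auto
    qed
  qed
qed

lemma len_le: "ts \<in> words N \<Longrightarrow> len N (word_prod ts) \<le> length ts"
  unfolding len_def by (rule Least_le) auto

lemma reduced_word:
  assumes "w \<in> Sym N" shows "\<exists>ts \<in> words N. length ts = len N w \<and> word_prod ts = w"
proof -
  have "\<exists>k. \<exists>ts \<in> words N. length ts = k \<and> word_prod ts = w"
    using word_exists[OF assms] by blast
  then show ?thesis unfolding len_def by (rule LeastI_ex)
qed

lemma len_inv: assumes "w \<in> Sym N" shows "len N (inv w) = len N w"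
proof -
  have *: "len N (inv u) \<le> len N u" if u: "u \<in> Sym N" for u
  proof -
    obtain ts where "ts \<in> words N" "length ts = len N u" "word_prod ts = u"
      using reduced_word[OF u] by auto
    then show ?thesis using len_le[of "rev ts" N] by (auto simp: inv_word_prod)
  qed
  show ?thesis using *[OF assms] *[OF Sym_inv[OF assms]] inv_inv_eq[OF Sym_bij[OF assms]] by simp
qed

lemma len_simple_le: assumes "w \<in> Sym N" "i \<in> {1..<N}"
  shows "len N (simple i \<circ> w) \<le> Suc (len N w)"
  using reduced_word[OF assms(1)] len_le[of "i # _" N] assms by fastforce

lemma exchange_word:
  assumes "ts \<in> words N" "inv (word_prod ts) (Suc i) < inv (word_prod ts) i"
  shows "\<exists>us \<in> words N. Suc (length us) = length ts \<and> word_prod us = simple i \<circ> word_prod ts"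
  using assms
proof (induction ts rule: rev_induct)
  case (snoc j ts)
  define q where "q = inv (word_prod ts)"
  have bq: "bij q" using bij_word_prod bij_imp_bij_inv q_def by blast
  have e: "inv (word_prod (ts @ [j])) = simple j \<circ> q"
    by (simp add: o_inv_distrib bij_simple inv_simple bij_word_prod q_def)
  show ?case
  proof (cases "q (Suc i) < q i")
    case True
    then obtain us where "us \<in> words N" "Suc (length us) = length ts"
      "word_prod us = simple i \<circ> word_prod ts"
      using snoc.IH snoc.prems(1) by (auto simp: q_def comp_def)
    then show ?thesis using snoc by (intro bexI[of _ "us @ [j]"]) (auto simp: comp_def)
  next
    case False
    have "q i \<noteq> q (Suc i)" using bq by (auto dest!: bij_is_inj injD)
    moreover have "simple j (q (Suc i)) < simple j (q i)"
      using snoc.prems(2)[unfolded e] by simp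
    ultimately have *: "q i = j" "q (Suc i) = Suc j" using False
      by (auto simp: simple_def transpose_def split: if_splits)
    then have "simple i \<circ> word_prod ts = word_prod ts \<circ> simple j"
      unfolding simple_def transpose_comp_eq[OF bij_word_prod] q_def by simp
    then have "simple i \<circ> word_prod (ts @ [j]) = word_prod ts"
      by (simp add: comp_assoc[symmetric])
    then show ?thesis using snoc.prems(1) by (intro bexI[of _ ts]) (auto simp: comp_def)
  qed
qed auto

lemma len_simple_less:
  assumes "w \<in> Sym N" "inv w (Suc i) < inv w i"
  shows "len N (simple i \<circ> w) < len N w"
proof -
  obtain ts where ts: "ts \<in> words N" "length ts = len N w" "word_prod ts = w"
    using reduced_word[OF assms(1)] by auto
  then obtain us where "us \<in> words N" "Suc (length us) = length ts"
    "word_prod us = simple i \<circ> word_prod ts"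
    using exchange_word[of ts N i] assms by auto
  then show ?thesis using len_le[of us N] ts by auto
qed

lemma len_simple_iff:
  assumes "w \<in> Sym N" "i \<in> {1..<N}"
  shows "len N w < len N (simple i \<circ> w) \<longleftrightarrow> inv w i < inv w (Suc i)"
    and "len N (simple i \<circ> w) \<noteq> len N w"
proof -
  have "inv w i \<noteq> inv w (Suc i)"
    using bij_imp_bij_inv[OF Sym_bij[OF assms(1)]] by (auto dest!: bij_is_inj injD)
  moreover have "len N w < len N (simple i \<circ> w)" if "inv w i < inv w (Suc i)"
  proof -
    have "inv (simple i \<circ> w) = inv w \<circ> simple i"
      using Sym_bij[OF assms(1)] by (simp add: o_inv_distrib bij_simple inv_simple)
    then show ?thesis
      using len_simple_less[OF Sym_comp[OF simple_Sym[OF assms(2)] assms(1)], of i] that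
      unfolding simple_comp_cancel by (simp add: simple_def)
  qed
  ultimately show "len N w < len N (simple i \<circ> w) \<longleftrightarrow> inv w i < inv w (Suc i)"
    "len N (simple i \<circ> w) \<noteq> len N w"
    using len_simple_less[OF assms(1), of i] by (metis less_linear less_asym less_irrefl)+
qed

lemma len_simple_right:
  assumes "w \<in> Sym N" "i \<in> {1..<N}"
  shows "len N (w \<circ> simple i) \<noteq> len N w" "len N (w \<circ> simple i) \<le> Suc (len N w)"
proof -
  have "inv (w \<circ> simple i) = simple i \<circ> inv w"
    using Sym_bij[OF assms(1)] by (simp add: o_inv_distrib bij_simple inv_simple)
  then show "len N (w \<circ> simple i) \<noteq> len N w" "len N (w \<circ> simple i) \<le> Suc (len N w)"
    using len_simple_iff(2)[OF Sym_inv[OF assms(1)] assms(2)]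
      len_simple_le[OF Sym_inv[OF assms(1)] assms(2)]
      len_inv[OF assms(1)] len_inv[OF Sym_comp[OF assms(1) simple_Sym[OF assms(2)]]]
    by auto
qed

definition lstep :: "nat \<Rightarrow> nat \<Rightarrow> (nat \<Rightarrow> nat) \<Rightarrow> (nat \<Rightarrow> nat)" where
  "lstep N i w = (if len N (simple i \<circ> w) > len N w then simple i \<circ> w else w)"

definition rstep :: "nat \<Rightarrow> nat \<Rightarrow> (nat \<Rightarrow> nat) \<Rightarrow> (nat \<Rightarrow> nat)" where
  "rstep N i w = (if len N (w \<circ> simple i) > len N w then w \<circ> simple i else w)"

lemma step_Sym:
  assumes "w \<in> Sym N" "i \<in> {1..<N}" shows "lstep N i w \<in> Sym N" "rstep N i w \<in> Sym N"
  using assms by (auto simp: lstep_def rstep_def intro!: Sym_comp simple_Sym)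

lemma exchange_both:
  assumes "w \<in> Sym N" "i \<in> {1..<N}" "j \<in> {1..<N}"
    and "len N w < len N (simple i \<circ> w)"
    and "\<not> len N (w \<circ> simple j) < len N (simple i \<circ> (w \<circ> simple j))"
  shows "simple i \<circ> w = w \<circ> simple j"
proof -
  note bw = Sym_bij[OF assms(1)]
  have e: "inv (w \<circ> simple j) = simple j \<circ> inv w"
    using bw by (simp add: o_inv_distrib bij_simple inv_simple)
  have "inv w i < inv w (Suc i)" using len_simple_iff(1)[OF assms(1,2)] assms(4) by simp
  moreover have "\<not> simple j (inv w i) < simple j (inv w (Suc i))"
    using len_simple_iff(1)[OF Sym_comp[OF assms(1) simple_Sym[OF assms(3)]] assms(2)] assms(5) e
    by simp
  ultimately have "inv w i = j" "inv w (Suc i) = Suc j"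
    by (auto simp: simple_def transpose_def split: if_splits)
  then show ?thesis
    unfolding simple_def transpose_comp_eq[OF bw] by simp
qed

lemma lstep_rstep:
  assumes "w \<in> Sym N" "i \<in> {1..<N}" "j \<in> {1..<N}"
  shows "lstep N i (rstep N j w) = rstep N j (lstep N i w)"
proof -
  have iw: "simple i \<circ> w \<in> Sym N" and wj: "w \<circ> simple j \<in> Sym N"
    using assms by (simp_all add: Sym_comp simple_Sym)
  define A B C D where "A = len N w" "B = len N (simple i \<circ> w)" "C = len N (w \<circ> simple j)"
    "D = len N (simple i \<circ> (w \<circ> simple j))"
  note defs = this
  have le: "B \<noteq> A" "B \<le> Suc A" "C \<noteq> A" "C \<le> Suc A" "D \<noteq> C" "D \<le> Suc C" "D \<noteq> B" "D \<le> Suc B"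
    using len_simple_iff(2)[OF assms(1,2)] len_simple_le[OF assms(1,2)]
      len_simple_iff(2)[OF wj assms(2)] len_simple_le[OF wj assms(2)]
      len_simple_right[OF assms(1,3)] len_simple_right[OF iw assms(3)]
    by (simp_all add: defs comp_assoc)
  have ex: "A < B \<Longrightarrow> \<not> C < D \<Longrightarrow> simple i \<circ> w = w \<circ> simple j"
    using exchange_both[OF assms] by (simp add: defs)
  have st: "lstep N i w = (if A < B then simple i \<circ> w else w)"
    "rstep N j w = (if A < C then w \<circ> simple j else w)"
    "lstep N i (w \<circ> simple j) = (if C < D then simple i \<circ> (w \<circ> simple j) else w \<circ> simple j)"
    "rstep N j (simple i \<circ> w) = (if B < D then simple i \<circ> (w \<circ> simple j) else simple i \<circ> w)"
    by (simp_all only: lstep_def rstep_def defs comp_assoc)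
  consider "A < B" "A < C" "C < D" "B < D" | "A < B" "A < C" "\<not> C < D" "\<not> B < D"
    | "A < B" "\<not> A < C" "\<not> B < D" | "\<not> A < B" "A < C" "\<not> C < D" | "\<not> A < B" "\<not> A < C"
    using le by linarith
  then show ?thesis
  proof cases
    case 2
    then have "lstep N i (rstep N j w) = w \<circ> simple j" "rstep N j (lstep N i w) = simple i \<circ> w"
      by (simp_all only: st if_True if_False)
    then show ?thesis using ex 2 by metis
  qed (simp_all only: st if_True if_False)
qed

lemma foldr_lstep_Sym:
  "ts \<in> words N \<Longrightarrow> w \<in> Sym N \<Longrightarrow> foldr (lstep N) ts w \<in> Sym N"
  by (induction ts) (auto intro: step_Sym)

lemma foldr_rstep_Sym:
  "ts \<in> words N \<Longrightarrow> w \<in> Sym N \<Longrightarrow> foldr (rstep N) ts w \<in> Sym N"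
  by (induction ts) (auto intro: step_Sym)

lemma foldr_lstep_rstep:
  assumes "ts \<in> words N" "j \<in> {1..<N}" "w \<in> Sym N"
  shows "foldr (lstep N) ts (rstep N j w) = rstep N j (foldr (lstep N) ts w)"
  using assms by (induction ts) (auto simp: lstep_rstep foldr_lstep_Sym)

lemma foldr_lstep_foldr_rstep:
  assumes "ts \<in> words N" "us \<in> words N" "w \<in> Sym N"
  shows "foldr (lstep N) ts (foldr (rstep N) us w) = foldr (rstep N) us (foldr (lstep N) ts w)"
  using assms(2) assms(1,3) by (induction us) (auto simp: foldr_lstep_rstep foldr_rstep_Sym)

lemma foldr_lstep_reduced:
  assumes "ts \<in> words N" "length ts = len N (word_prod ts)"
  shows "foldr (lstep N) ts id = word_prod ts"
  using assms
proof (induction ts)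
  case (Cons i ts)
  have "len N (simple i \<circ> word_prod ts) \<le> Suc (len N (word_prod ts))"
    using Cons.prems by (intro len_simple_le word_prod_Sym) auto
  with Cons.prems(2)[unfolded word_prod_simps] Cons.prems(1) len_le[of ts N]
  have l: "length ts = len N (word_prod ts)" by (auto simp: comp_def)
  have "ts \<in> words N" using Cons.prems(1) by simp
  then have "foldr (lstep N) ts id = word_prod ts" using Cons.IH l by blast
  then show ?case using l Cons.prems(2)
    unfolding word_prod_simps foldr.simps comp_apply lstep_def by simp
qed auto

lemma foldr_rstep_reduced:
  assumes "ts \<in> words N" "length ts = len N (word_prod (rev ts))"
  shows "foldr (rstep N) ts id = word_prod (rev ts)"
  using assms
proof (induction ts)
  case (Cons i ts)
  have "len N (word_prod (rev ts) \<circ> simple i) \<le> Suc (len N (word_prod (rev ts)))"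
    using Cons.prems by (intro len_simple_right word_prod_Sym) auto
  with Cons.prems(2)[unfolded rev.simps word_prod_append word_prod_simps comp_id] Cons.prems(1)
    len_le[of "rev ts" N]
  have l: "length ts = len N (word_prod (rev ts))" by (auto simp: comp_def)
  have "ts \<in> words N" using Cons.prems(1) by simp
  then have "foldr (rstep N) ts id = word_prod (rev ts)" using Cons.IH l by blast
  then show ?case using l Cons.prems(2)
    unfolding rev.simps word_prod_append word_prod_simps comp_id foldr.simps comp_apply rstep_def
    by simp
qed auto

lemma foldr_lstep_cong:
  assumes "ts \<in> words N" "us \<in> words N" "foldr (lstep N) ts id = foldr (lstep N) us id"
    and "w \<in> Sym N"
  shows "foldr (lstep N) ts w = foldr (lstep N) us w"
proof -
  obtain vs where "vs \<in> words N" "length vs = len N w" "word_prod vs = w"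
    using reduced_word[OF assms(4)] by auto
  then have vs: "rev vs \<in> words N" "foldr (rstep N) (rev vs) id = w"
    using foldr_rstep_reduced[of "rev vs" N] by auto
  show ?thesis
    using foldr_lstep_foldr_rstep[OF assms(1) vs(1) id_Sym]
      foldr_lstep_foldr_rstep[OF assms(2) vs(1) id_Sym] assms(3)
    unfolding vs(2) by metis
qed

lemma exists_demazure: "\<exists>op. is_demazure N op"
proof -
  have "\<forall>w \<in> Sym N. \<exists>ts \<in> words N. foldr (lstep N) ts id = w"
    using reduced_word foldr_lstep_reduced by metis
  then obtain red where r: "\<And>w. w \<in> Sym N \<Longrightarrow> red w \<in> words N"
    "\<And>w. w \<in> Sym N \<Longrightarrow> foldr (lstep N) (red w) id = w"
    by metis
  define op where "op u v = foldr (lstep N) (red u) v" for u v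
  have S: "op u v \<in> Sym N" if "u \<in> Sym N" "v \<in> Sym N" for u v
    unfolding op_def using that r by (intro foldr_lstep_Sym)
  have a: "op (op u v) w = op u (op v w)" if uvw: "u \<in> Sym N" "v \<in> Sym N" "w \<in> Sym N" for u v w
  proof -
    have "foldr (lstep N) (red (op u v)) id = foldr (lstep N) (red u @ red v) id"
      unfolding foldr_append comp_apply r(2)[OF S[OF uvw(1,2)]] r(2)[OF uvw(2)]
      unfolding op_def ..
    from foldr_lstep_cong[OF r(1)[OF S[OF uvw(1,2)]] _ this uvw(3)]
    have "op (op u v) w = foldr (lstep N) (red u @ red v) w"
      using r(1)[OF uvw(1)] r(1)[OF uvw(2)] unfolding op_def by simp
    then show ?thesis unfolding op_def foldr_append comp_apply .
  qed
  have e: "op id w = w \<and> op w id = w" if "w \<in> Sym N" for w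
    using foldr_lstep_cong[of "red id" N "[]" w, OF r(1)[OF id_Sym]] r(2)[OF id_Sym] r(2)[OF that] that
    unfolding op_def by simp
  have s: "lstep N i id = simple i" "rstep N i id = simple i" if "i \<in> {1..<N}" for i
    using len_simple_iff(1)[OF id_Sym that] unfolding lstep_def rstep_def by simp_all
  have l: "op (simple i) w = lstep N i w" if iw: "i \<in> {1..<N}" "w \<in> Sym N" for i w
  proof -
    note si = simple_Sym[OF iw(1)]
    have "foldr (lstep N) (red (simple i)) id = foldr (lstep N) [i] id"
      unfolding r(2)[OF si] using s(1)[OF iw(1)] by simp
    from foldr_lstep_cong[OF r(1)[OF si] _ this iw(2)] show ?thesis
      using iw(1) unfolding op_def by simp
  qed
  have "op w (simple i) = rstep N i w" if iw: "i \<in> {1..<N}" "w \<in> Sym N" for i w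
    using foldr_lstep_rstep[OF r(1)[OF iw(2)] iw(1) id_Sym]
    unfolding r(2)[OF iw(2)] s(2)[OF iw(1)] op_def .
  with S a e l have "is_demazure N op"
    unfolding is_demazure_def lstep_def rstep_def by blast
  then show ?thesis by blast
qed

lemma is_demazure_foldr:
  assumes "is_demazure N op" "ts \<in> words N" "length ts = len N (word_prod ts)" "w \<in> Sym N"
  shows "op (word_prod ts) w = foldr (lstep N) ts w"
  using assms(2,3)
proof (induction ts)
  case Nil
  show ?case unfolding word_prod_simps using assms(1,4)
    by (auto simp: is_demazure_def simp flip: id_def)
next
  case (Cons i ts)
  have "len N (simple i \<circ> word_prod ts) \<le> Suc (len N (word_prod ts))"
    using Cons.prems by (intro len_simple_le word_prod_Sym) auto
  with Cons.prems(2)[unfolded word_prod_simps] Cons.prems(1) len_le[of ts N]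
  have l: "length ts = len N (word_prod ts)" by (auto simp: comp_def)
  have i: "i \<in> {1..<N}" "simple i \<in> Sym N" "word_prod ts \<in> Sym N"
    using Cons.prems by (auto intro: simple_Sym word_prod_Sym)
  have st: "op (simple i) v = lstep N i v" if "v \<in> Sym N" for v
    using assms(1) i that unfolding is_demazure_def lstep_def by auto
  have "op (simple i) (word_prod ts) = word_prod (i # ts)"
    using st[OF i(3)] l Cons.prems(2) unfolding word_prod_simps lstep_def
    by (simp add: comp_def)
  then have "op (word_prod (i # ts)) w = op (simple i) (op (word_prod ts) w)"
    using assms(1,4) i unfolding is_demazure_def by metis
  also have "\<dots> = lstep N i (foldr (lstep N) ts w)"
    using Cons l st assms(4) foldr_lstep_Sym by simp
  finally show ?case by (simp add: comp_def)
qed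

lemma ex1_demazure:
  "\<exists>!op. is_demazure N op \<and> (\<forall>u v. \<not> (u \<in> Sym N \<and> v \<in> Sym N) \<longrightarrow> op u v = id)"
proof -
  obtain op where op: "is_demazure N op" using exists_demazure by auto
  define op' where "op' u v = (if u \<in> Sym N \<and> v \<in> Sym N then op u v else id)" for u v
  have "is_demazure N op'"
    using op simple_Sym[of _ N] unfolding is_demazure_def op'_def by simp
  moreover have "f = g"
    if "is_demazure N f \<and> (\<forall>u v. \<not> (u \<in> Sym N \<and> v \<in> Sym N) \<longrightarrow> f u v = id)"
      "is_demazure N g \<and> (\<forall>u v. \<not> (u \<in> Sym N \<and> v \<in> Sym N) \<longrightarrow> g u v = id)" for f g
  proof (intro ext)
    fix u v a
    have "f u v = g u v"
    proof (cases "u \<in> Sym N \<and> v \<in> Sym N")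
      case True
      then show ?thesis using reduced_word[of u N] is_demazure_foldr that by metis
    qed (use that in auto)
    then show "f u v a = g u v a" by simp
  qed
  ultimately show ?thesis by (intro ex1I[of _ op']) (auto simp: op'_def)
qed

lemma is_demazure_demazure: "is_demazure N (demazure N)"
  using theI'[OF ex1_demazure, of N] unfolding demazure_def by blast

end

theory Submission
  imports Defs
begin

text \<open>
  For a fixed-point-free involution \<open>y\<close>, the element \<open>s\<^sub>i \<circ> y \<circ> s\<^sub>i\<close> (Demazure product) is the ordinary
  conjugate, of length \<open>\<ell>(y) + 2\<close>, if \<open>y(i) < y(i+1)\<close>, and is \<open>y\<close> otherwise.  So the shortest words
  leading to \<open>x\<close> are the paths from \<open>w_fpf\<close> to \<open>x\<close> in which every step raises the length, and both
  kinds of relations preserve them.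

  Conversely, two paths to \<open>x\<close> are compared by induction on their length.  If they end in \<open>i < j\<close>,
  one can usually descend from \<open>x\<close> along the whole dihedral orbit of \<open>s\<^sub>i\<close> and \<open>s\<^sub>j\<close>, and a braid
  relation connects them.  The only exception is that \<open>x\<close> has the nested arcs \<open>(i, j+1)\<close> and
  \<open>(i+1, j)\<close>.  Then both paths come from the same \<open>y\<close>, with arcs \<open>(i, j)\<close> and \<open>(i+1, j+1)\<close>, and it
  suffices to find one path \<open>a\<close> to \<open>y\<close> such that \<open>a\<cdot>i\<close> and \<open>a\<cdot>j\<close> are equivalent.  Descending from \<open>y\<close> brings
  the two arcs together until \<open>j = i + 2\<close>; then the block \<open>{i,\<dots>,i+3}\<close> is moved through the other
  arcs until the rest is \<open>w_fpf\<close>, where the initial relation applies.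
\<close>

subsection \<open>Conjugating fixed-point-free involutions\<close>

definition fpf_conj :: "nat \<Rightarrow> (nat \<Rightarrow> nat) \<Rightarrow> nat \<Rightarrow> nat" where
  "fpf_conj i y = simple i \<circ> y \<circ> simple i"

lemma fpf_conj_apply: "fpf_conj i y a = simple i (y (simple i a))"
  by (simp add: fpf_conj_def)

lemma simple_apply: "simple i a = (if a = i then Suc i else if a = Suc i then i else a)"
  by (auto simp: simple_def transpose_def)

lemma fpf_conj_fpf_conj [simp]: "fpf_conj i (fpf_conj i y) = y"
  by (simp add: fun_eq_iff fpf_conj_apply)

lemma fpf_involutionD:
  assumes "fpf_involution N y"
  shows "y \<in> Sym N" "y (y a) = a" "inv y = y" "y a = y b \<longleftrightarrow> a = b"
    "a \<in> {1..N} \<Longrightarrow> y a \<noteq> a" "y a \<in> {1..N} \<longleftrightarrow> a \<in> {1..N}" "a \<notin> {1..N} \<Longrightarrow> y a = a"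
proof -
  show S: "y \<in> Sym N" and 2: "y (y a) = a" for a
    using assms by (auto simp: fpf_involution_def fun_eq_iff)
  show "inv y = y" using 2 by (intro inv_unique_comp) auto
  show "y a = y b \<longleftrightarrow> a = b" using 2 by metis
  show "y a \<in> {1..N} \<longleftrightarrow> a \<in> {1..N}" "a \<notin> {1..N} \<Longrightarrow> y a = a"
    using S permutes_in_image[of y "{1..N}"] permutes_not_in[of y "{1..N}"]
    unfolding Sym_def by blast+
  show "a \<in> {1..N} \<Longrightarrow> y a \<noteq> a" using assms by (auto simp: fpf_involution_def)
qed

lemma fpf_involution_conj:
  assumes "fpf_involution N y" "i \<in> {1..<N}"
  shows "fpf_involution N (fpf_conj i y)"
proof -
  have "fpf_conj i y \<in> Sym N"
    using fpf_involutionD(1)[OF assms(1)] assms(2) by (simp add: fpf_conj_def Sym_comp simple_Sym)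
  moreover have "fpf_conj i y a \<noteq> a" if "a \<in> {1..N}" for a
  proof
    assume "fpf_conj i y a = a"
    then have "y (simple i a) = simple i a" unfolding fpf_conj_apply by (metis simple_simple(2))
    moreover have "simple i a \<in> {1..N}" using that assms(2) by (auto simp: simple_apply)
    ultimately show False using fpf_involutionD(5)[OF assms(1)] by blast
  qed
  ultimately show ?thesis
    using fpf_involutionD(2)[OF assms(1)]
    by (auto simp: fpf_involution_def fun_eq_iff fpf_conj_apply)
qed

text \<open>An arc joining \<open>i\<close> and \<open>Suc i\<close> would give
  \<open>y i = Suc i\<close> and \<open>y (Suc i) = i\<close>, which is a descent; fixed points are
  excluded for \<open>y\<close>.\<close>

lemma fpf_ascent_notin:
  assumes "fpf_involution N y" "i \<in> {1..<N}" "y i < y (Suc i)"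
  shows "y i \<noteq> i" "y i \<noteq> Suc i" "y (Suc i) \<noteq> i" "y (Suc i) \<noteq> Suc i"
  using fpf_involutionD[OF assms(1)] assms(2,3)
  by (metis atLeastLessThan_iff atLeastAtMost_iff le_SucI less_imp_le_nat Suc_leI less_not_sym lessI)+

text \<open>Since \<open>y\<close> is its own inverse, an ascent of \<open>y\<close> makes left
  multiplication by \<open>simple i\<close> raise the length. The products
  \<open>simple i \<circ> y\<close> and \<open>y \<circ> simple i\<close> are mutually inverse,
  hence equally long. The second multiplication raises the length again because
  \<open>simple i\<close> fixes both values \<open>y i\<close> and \<open>y (Suc i)\<close>.\<close>

lemma fpf_conj_steps:
  assumes "fpf_involution N y" "i \<in> {1..<N}" "y i < y (Suc i)"
  shows "rstep N i (lstep N i y) = fpf_conj i y" "len N (fpf_conj i y) = len N y + 2"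
proof -
  note y = fpf_involutionD[OF assms(1)]
  note ns = fpf_ascent_notin[OF assms]
  let ?s = "simple i"
  have inv: "inv (?s \<circ> y) = y \<circ> ?s"
    using Sym_bij[OF y(1)] by (simp add: o_inv_distrib bij_simple inv_simple y(3))
  have inv': "inv (y \<circ> ?s) = ?s \<circ> y"
    using Sym_bij[OF y(1)] by (simp add: o_inv_distrib bij_simple inv_simple y(3))
  have sy: "?s \<circ> y \<in> Sym N" and ys: "y \<circ> ?s \<in> Sym N"
    using y(1) assms(2) by (simp_all add: Sym_comp simple_Sym)
  have c: "inv (fpf_conj i y) = ?s \<circ> (y \<circ> ?s)"
    using fpf_involutionD(3)[OF fpf_involution_conj[OF assms(1,2)]]
    by (simp add: fpf_conj_def comp_assoc)
  have 1: "len N y < len N (?s \<circ> y)"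
    using len_simple_iff(1)[OF y(1) assms(2)] assms(3) y(3) by simp
  have 2: "len N (y \<circ> ?s) < len N (?s \<circ> (y \<circ> ?s))"
    using len_simple_iff(1)[OF ys assms(2)] assms(3) ns unfolding inv'
    by (simp add: simple_apply)
  have 3: "len N (y \<circ> ?s) = len N (?s \<circ> y)" using len_inv[OF sy] inv by simp
  have "fpf_conj i y = ?s \<circ> (y \<circ> ?s)" by (simp add: fpf_conj_def comp_assoc)
  then show "len N (fpf_conj i y) = len N y + 2"
    using 1 2 3 len_simple_le[OF y(1) assms(2)] len_simple_le[OF ys assms(2)] by simp
  show "rstep N i (lstep N i y) = fpf_conj i y"
    using 1 2 3 by (simp add: lstep_def rstep_def fpf_conj_def comp_assoc)
qed

text \<open>The left and the right product with \<open>simple i\<close> are mutually inverse, so if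
  one does not raise the length, neither does the other.\<close>

lemma fpf_conj_steps_id:
  assumes "fpf_involution N y" "i \<in> {1..<N}" "\<not> y i < y (Suc i)"
  shows "rstep N i (lstep N i y) = y"
proof -
  note y = fpf_involutionD[OF assms(1)]
  have 1: "\<not> len N y < len N (simple i \<circ> y)"
    using len_simple_iff(1)[OF y(1) assms(2)] assms(3) y(3) by simp
  have "inv (simple i \<circ> y) = y \<circ> simple i"
    using Sym_bij[OF y(1)] by (simp add: o_inv_distrib bij_simple inv_simple y(3))
  then have "len N (y \<circ> simple i) = len N (simple i \<circ> y)"
    using len_inv[of "simple i \<circ> y" N] y(1) assms(2) by (simp add: Sym_comp simple_Sym)
  then show ?thesis using 1 by (simp add: lstep_def rstep_def)
qed

section \<open>Demazure conjugation by a word as iterated conjugation\<close>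

definition fpf_step :: "nat \<Rightarrow> (nat \<Rightarrow> nat) \<Rightarrow> nat \<Rightarrow> nat" where
  "fpf_step i y = (if y i < y (Suc i) then fpf_conj i y else y)"

lemma fpf_involution_step:
  "fpf_involution N y \<Longrightarrow> i \<in> {1..<N} \<Longrightarrow> fpf_involution N (fpf_step i y)"
  by (simp add: fpf_step_def fpf_involution_conj)

lemma demazure_simple:
  assumes "i \<in> {1..<N}" "w \<in> Sym N"
  shows "demazure N (simple i) w = lstep N i w" "demazure N w (simple i) = rstep N i w"
  using is_demazure_demazure[of N] assms unfolding is_demazure_def lstep_def rstep_def by blast+

lemma demazure_word_foldr:
  assumes "ts \<in> words N"
  shows "demazure_word N ts = foldr (lstep N) ts id"
  using assms by (induction ts) (simp_all add: demazure_word_def demazure_simple foldr_lstep_Sym)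

text \<open>Inversion preserves length and reverses products, so it exchanges left and right
  steps.\<close>

lemma inv_lstep:
  assumes "i \<in> {1..<N}" "w \<in> Sym N"
  shows "inv (lstep N i w) = rstep N i (inv w)"
proof -
  have "inv (simple i \<circ> w) = inv w \<circ> simple i"
    using Sym_bij[OF assms(2)] by (simp add: o_inv_distrib bij_simple inv_simple)
  then show ?thesis
    using len_inv[OF assms(2)] len_inv[of "simple i \<circ> w" N] assms
    by (simp add: lstep_def rstep_def Sym_comp simple_Sym)
qed

text \<open>The inverse of the product of \<open>simple i\<close> and the rest \<open>W\<close> is
  the product of \<open>inv W\<close> and \<open>simple i\<close>; associativity then brings both
  copies of \<open>simple i\<close> next to \<open>y\<close>.\<close>

lemma demazure_conj_Cons:
  assumes "i \<in> {1..<N}" "ts \<in> words N" "fpf_involution N y"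
  shows "demazure_conj N y (i # ts) = demazure_conj N (fpf_step i y) ts"
proof -
  let ?s = "simple i" and ?W = "demazure_word N ts" and ?d = "demazure N"
  have W: "?W \<in> Sym N" "inv ?W \<in> Sym N" "?s \<in> Sym N" "y \<in> Sym N"
    using assms by (simp_all add: demazure_word_foldr foldr_lstep_Sym Sym_inv simple_Sym
        fpf_involutionD(1))
  have S: "\<And>u v. u \<in> Sym N \<Longrightarrow> v \<in> Sym N \<Longrightarrow> ?d u v \<in> Sym N"
    and A: "\<And>u v w. u \<in> Sym N \<Longrightarrow> v \<in> Sym N \<Longrightarrow> w \<in> Sym N \<Longrightarrow>
      ?d (?d u v) w = ?d u (?d v w)"
    using is_demazure_demazure[of N] unfolding is_demazure_def by blast+
  have w: "demazure_word N (i # ts) = ?d ?s ?W" by (simp add: demazure_word_def)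
  have "inv (?d ?s ?W) = ?d (inv ?W) ?s"
    using assms W by (simp add: demazure_simple inv_lstep)
  then have "demazure_conj N y (i # ts) = ?d (?d (inv ?W) (?d (?d ?s y) ?s)) ?W"
    unfolding demazure_conj_def w using W by (simp add: S A)
  moreover have "?d (?d ?s y) ?s = fpf_step i y"
    using assms W fpf_conj_steps(1)[OF assms(3,1)] fpf_conj_steps_id[OF assms(3,1)]
    by (simp add: demazure_simple step_Sym fpf_step_def)
  ultimately show ?thesis by (simp add: demazure_conj_def)
qed

text \<open>The first letter is the innermost one in the conjugation, hence \<open>fold\<close>
  rather than \<open>foldr\<close>.\<close>

lemma demazure_conj_fold:
  assumes "ts \<in> words N" "fpf_involution N y"
  shows "demazure_conj N y ts = fold fpf_step ts y"
  using assms
proof (induction ts arbitrary: y)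
  case Nil
  have "demazure N id y = y" "demazure N y id = y"
    using is_demazure_demazure[of N] fpf_involutionD(1)[OF Nil(2)]
    unfolding is_demazure_def by blast+
  then show ?case by (simp add: demazure_conj_def demazure_word_def inv_id[unfolded id_def] flip: id_def)
next
  case (Cons i ts)
  then show ?case by (simp add: demazure_conj_Cons fpf_involution_step)
qed

lemma w_fpf_apply:
  "w_fpf n a = (if a \<in> {1..2 * n} then (if odd a then Suc a else a - 1) else a)"
proof (induction n arbitrary: a)
  case (Suc n)
  have "w_fpf (Suc n) a = w_fpf n (simple (Suc (2 * n)) a)" by (simp add: w_fpf_def)
  then show ?case unfolding Suc by (auto simp: simple_apply le_Suc_eq)
qed (simp add: w_fpf_def)

lemma fpf_involution_w_fpf: "fpf_involution (2 * n) (w_fpf n)"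
proof -
  have "w_fpf n \<in> Sym (2 * n)" unfolding w_fpf_def by (intro word_prod_Sym) (auto simp: words_def)
  then show ?thesis unfolding fpf_involution_def
    by (auto simp: w_fpf_apply fun_eq_iff elim!: oddE) presburger
qed

subsection \<open>Length-raising paths\<close>

text \<open>Letters are appended because the last letter conjugates outermost. The last letter of a
  path is thus a descent of its endpoint, which suits an induction from the end.\<close>

inductive fpf_path :: "nat \<Rightarrow> nat list \<Rightarrow> (nat \<Rightarrow> nat) \<Rightarrow> bool" for n where
  Nil: "fpf_path n [] (w_fpf n)"
| snoc: "fpf_path n ts y \<Longrightarrow> i \<in> {1..<2 * n} \<Longrightarrow> y i < y (Suc i) \<Longrightarrow>
    fpf_path n (ts @ [i]) (fpf_conj i y)"

text \<open>Every step adds exactly 2 to \<open>len\<close>, so the number of letters of a path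
  depends only on its endpoint.\<close>

lemma fpf_pathD:
  assumes "fpf_path n ts y"
  shows "ts \<in> words (2 * n)" "fpf_involution (2 * n) y"
    "len (2 * n) y = len (2 * n) (w_fpf n) + 2 * length ts"
    "fold fpf_step ts (w_fpf n) = y"
proof -
  have "ts \<in> words (2 * n) \<and> fpf_involution (2 * n) y \<and>
    len (2 * n) y = len (2 * n) (w_fpf n) + 2 * length ts \<and> fold fpf_step ts (w_fpf n) = y"
    using assms
    by induction (auto simp: fpf_involution_w_fpf fpf_involution_conj fpf_conj_steps fpf_step_def)
  then show "ts \<in> words (2 * n)" "fpf_involution (2 * n) y"
    "len (2 * n) y = len (2 * n) (w_fpf n) + 2 * length ts"
    "fold fpf_step ts (w_fpf n) = y" by auto
qed

text \<open>Converse of \<open>fpf_conj_steps\<close>. The case \<open>y i = Suc i\<close> is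
  excluded because there conjugation leaves \<open>y\<close> unchanged.\<close>

lemma fpf_descent:
  assumes "fpf_involution N y" "i \<in> {1..<N}" "y (Suc i) < y i" "y i \<noteq> Suc i"
  shows "fpf_involution N (fpf_conj i y)" "fpf_conj i y i < fpf_conj i y (Suc i)"
    "len N (fpf_conj i y) < len N y"
proof -
  note y = fpf_involutionD[OF assms(1)]
  show f: "fpf_involution N (fpf_conj i y)" using assms by (simp add: fpf_involution_conj)
  have "y i \<noteq> i" "y (Suc i) \<noteq> Suc i" "y (Suc i) \<noteq> i"
    using assms(2,4) y(5)[of i] y(5)[of "Suc i"] y(2)[of "Suc i"] by auto
  then show l: "fpf_conj i y i < fpf_conj i y (Suc i)"
    using assms(3,4) by (simp add: fpf_conj_apply simple_apply)
  show "len N (fpf_conj i y) < len N y" using fpf_conj_steps(2)[OF f assms(2) l] by simp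
qed

lemma fpf_path_descent:
  assumes "fpf_involution (2 * n) y" "i \<in> {1..<2 * n}" "y (Suc i) < y i" "y i \<noteq> Suc i"
    "fpf_path n a (fpf_conj i y)"
  shows "fpf_path n (a @ [i]) y"
  using fpf_path.snoc[OF assms(5,2) fpf_descent(2)[OF assms(1-4)]] by simp

text \<open>If the only descents are those inside arcs \<open>(i, Suc i)\<close>, then strong
  induction on \<open>m\<close> shows that \<open>2 * m + 1\<close> is matched with
  \<open>2 * m + 2\<close>, which forces \<open>w_fpf\<close>.\<close>

lemma fpf_descent_exists:
  assumes "fpf_involution (2 * n) y" "y \<noteq> w_fpf n"
  shows "\<exists>i \<in> {1..<2 * n}. y (Suc i) < y i \<and> y i \<noteq> Suc i"
proof (rule ccontr)
  assume "\<not> ?thesis"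
  moreover note y = fpf_involutionD[OF assms(1)]
  ultimately have up: "y i < y (Suc i) \<or> y i = Suc i" if "i \<in> {1..<2 * n}" for i
    using that y(4)[of i "Suc i"] by (metis linorder_neqE_nat n_not_Suc_n)
  have pair: "y (Suc (2 * m)) = Suc (Suc (2 * m))" if "m < n" for m
    using that
  proof (induction m rule: less_induct)
    case (less m)
    define q where "q = y (Suc (2 * m))"
    have yq: "y q = Suc (2 * m)" by (simp add: q_def y(2))
    have q: "q \<in> {1..2 * n}" "q \<noteq> Suc (2 * m)"
      using y(5,6)[of "Suc (2 * m)"] less.prems by (auto simp: q_def)
    \<comment> \<open>By the induction hypothesis the points up to \<open>2 * m\<close> are matched
      among themselves.\<close>
    have "Suc (2 * m) < q"
    proof (rule ccontr)
      assume "\<not> ?thesis"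
      then have "q \<le> 2 * m" using q by simp
      then obtain r where "r < m" "q = Suc (2 * r) \<or> q = Suc (Suc (2 * r))"
        using q(1) by (cases "odd q") (force elim!: oddE evenE intro: that[of "q div 2"]
            that[of "(q - 1) div 2"] that[of "q div 2 - 1"])+
      moreover have "y (Suc (2 * r)) = Suc (Suc (2 * r))" using less calculation by auto
      ultimately have "q = Suc (2 * m) \<or> Suc (2 * m) = Suc (2 * r) \<or> Suc (2 * m) = Suc (Suc (2 * r))"
        using y(2)[of "Suc (2 * r)"] yq by metis
      then show False using \<open>r < m\<close> \<open>q \<le> 2 * m\<close> by presburger
    qed
    show ?case
    proof (rule ccontr)
      assume ne: "\<not> ?thesis"
      \<comment> \<open>Without usable descents the values cannot fall below \<open>q\<close> on the
        way from \<open>Suc (2 * m)\<close> to its partner \<open>q\<close>, where the value is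
        \<open>Suc (2 * m)\<close>.\<close>
      have "q \<le> y k" if "Suc (2 * m) \<le> k" "k \<le> q" for k
        using that
      proof (induction k rule: dec_induct)
        case (step k)
        have "k \<in> {1..<2 * n}" using step q by auto
        then have "y k < y (Suc k) \<or> y k = Suc k" by (rule up)
        moreover have "y k \<noteq> Suc k"
        proof
          assume "y k = Suc k"
          then have "y k = q" using step by simp
          then have "k = Suc (2 * m)" using y(4) q_def by blast
          then show False using ne \<open>y k = Suc k\<close> by simp
        qed
        ultimately show ?case using step by simp
      qed (simp add: q_def)
      from this[of q] show False using \<open>Suc (2 * m) < q\<close> yq by simp
    qed
  qed
  have "y a = w_fpf n a" for a
  proof (cases "a \<in> {1..2 * n}")
    case True
    show ?thesis
    proof (cases "odd a")
      case o: True
      then obtain m where "a = Suc (2 * m)" by (auto elim: oddE)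
      then show ?thesis using True pair[of m] by (simp add: w_fpf_apply)
    next
      case False
      then obtain k where "a = 2 * k" by (auto elim: evenE)
      then obtain m where "a = Suc (Suc (2 * m))" using True by (cases k) auto
      then show ?thesis using True pair[of m] y(2)[of "Suc (2 * m)"] by (simp add: w_fpf_apply)
    qed
  qed (use y(7)[of a] in \<open>auto simp: w_fpf_apply\<close>)
  then show False using assms(2) by auto
qed

lemma fpf_path_exists:
  assumes "fpf_involution (2 * n) y"
  shows "\<exists>ts. fpf_path n ts y"
  using assms
proof (induction "len (2 * n) y" arbitrary: y rule: less_induct)
  case less
  show ?case
  proof (cases "y = w_fpf n")
    case True then show ?thesis using fpf_path.Nil by blast
  next
    case False
    then obtain i where i: "i \<in> {1..<2 * n}" "y (Suc i) < y i" "y i \<noteq> Suc i"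
      using fpf_descent_exists[OF less.prems] by blast
    note d = fpf_descent[OF less.prems i]
    show ?thesis using less.hyps[OF d(3,1)] fpf_path_descent[OF less.prems i] by blast
  qed
qed

text \<open>A letter adds 2 to the length if it is an ascent and 0 otherwise, so the bound is
  attained only when every letter is an ascent.\<close>

lemma fpf_path_if_len:
  assumes "ts \<in> words (2 * n)"
  shows "fpf_involution (2 * n) (fold fpf_step ts (w_fpf n)) \<and>
    len (2 * n) (fold fpf_step ts (w_fpf n)) \<le> len (2 * n) (w_fpf n) + 2 * length ts \<and>
    (len (2 * n) (fold fpf_step ts (w_fpf n)) = len (2 * n) (w_fpf n) + 2 * length ts \<longrightarrow>
     fpf_path n ts (fold fpf_step ts (w_fpf n)))"
  using assms
proof (induction ts rule: rev_induct)
  case (snoc i ts)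
  then have IH: "fpf_involution (2 * n) (fold fpf_step ts (w_fpf n))"
    "len (2 * n) (fold fpf_step ts (w_fpf n)) \<le> len (2 * n) (w_fpf n) + 2 * length ts"
    "len (2 * n) (fold fpf_step ts (w_fpf n)) = len (2 * n) (w_fpf n) + 2 * length ts \<Longrightarrow>
     fpf_path n ts (fold fpf_step ts (w_fpf n))" and i: "i \<in> {1..<2 * n}" by auto
  show ?case
    using IH(1,2) fpf_conj_steps(2)[OF IH(1) i] fpf_path.snoc[OF IH(3) i]
      fpf_involution_conj[OF IH(1) i]
    by (cases "fold fpf_step ts (w_fpf n) i < fold fpf_step ts (w_fpf n) (Suc i)")
      (simp_all add: fpf_step_def[of i])
qed (simp add: fpf_involution_w_fpf fpf_path.Nil)

text \<open>Some path to \<open>x\<close> exists; every word leading to \<open>x\<close> has at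
  least as many letters, and one with as few letters attains the bound of
  \<open>fpf_path_if_len\<close>.\<close>

lemma inv_words_fpf_path:
  assumes "fpf_involution (2 * n) x"
  shows "inv_words (2 * n) (w_fpf n) x = {ts. fpf_path n ts x}"
proof -
  obtain us where us: "fpf_path n us x" using fpf_path_exists[OF assms] by blast
  note dc = demazure_conj_fold[OF _ fpf_involution_w_fpf]
  have len: "length us \<le> length ts" "length ts \<le> length us \<longrightarrow> fpf_path n ts x"
    if "ts \<in> words (2 * n)" "fold fpf_step ts (w_fpf n) = x" for ts
    using fpf_path_if_len[OF that(1)] fpf_pathD(3)[OF us] that(2) by auto
  show ?thesis
  proof (intro equalityI subsetI; clarify)
    fix ts assume "ts \<in> inv_words (2 * n) (w_fpf n) x"
    then show "fpf_path n ts x"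
      using len(2)[of ts] us dc fpf_pathD[OF us] by (auto simp: inv_words_def)
  next
    fix ts assume ts: "fpf_path n ts x"
    then show "ts \<in> inv_words (2 * n) (w_fpf n) x"
      using len(1) dc fpf_pathD[OF us] fpf_pathD[OF ts] by (auto simp: inv_words_def)
  qed
qed

subsection \<open>Invariance under the relations\<close>

text \<open>On inverses, a left step sorts the entries in positions \<open>i\<close> and \<open>i + 1\<close> into decreasing order.\<close>
lemma lstep_eq_inv:
  assumes "i \<in> {1..<N}" "w \<in> Sym N"
  shows "inv (lstep N i w) =
    (inv w)(i := max (inv w i) (inv w (Suc i)), Suc i := min (inv w i) (inv w (Suc i)))"
proof -
  have "inv (simple i \<circ> w) = inv w \<circ> simple i"
    using Sym_bij[OF assms(2)] by (simp add: o_inv_distrib bij_simple inv_simple)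
  then show ?thesis
    using len_simple_iff(1)[OF assms(2,1)]
    by (auto simp: lstep_def fun_eq_iff simple_apply max_def min_def)
qed

lemma inv_Sym_inject: "u \<in> Sym N \<Longrightarrow> v \<in> Sym N \<Longrightarrow> inv u = inv v \<Longrightarrow> u = v"
  by (metis Sym_bij inv_inv_eq)

lemma lstep_commute:
  assumes "i \<in> {1..<N}" "j \<in> {1..<N}" "\<bar>int i - int j\<bar> > 1" "w \<in> Sym N"
  shows "lstep N i (lstep N j w) = lstep N j (lstep N i w)"
  by (rule inv_Sym_inject[of _ N])
    (use assms in \<open>auto simp: step_Sym lstep_eq_inv fun_eq_iff\<close>)

text \<open>On inverses, both sides sort three consecutive entries into decreasing order.\<close>

lemma lstep_braid:
  assumes "i \<in> {1..<N}" "Suc i \<in> {1..<N}" "w \<in> Sym N"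
  shows "lstep N i (lstep N (Suc i) (lstep N i w)) =
    lstep N (Suc i) (lstep N i (lstep N (Suc i) w))"
proof (rule inv_Sym_inject[of _ N], goal_cases)
  case 3
  show ?case
  proof
    fix k
    define a b c where "a = inv w i" "b = inv w (Suc i)" "c = inv w (Suc (Suc i))"
    note abc = this
    consider "k = i" | "k = Suc i" | "k = Suc (Suc i)" | "k \<notin> {i, Suc i, Suc (Suc i)}" by auto
    then show "inv (lstep N i (lstep N (Suc i) (lstep N i w))) k =
      inv (lstep N (Suc i) (lstep N i (lstep N (Suc i) w))) k"
      using assms by cases (simp_all add: step_Sym lstep_eq_inv flip: abc)
  qed
qed (use assms in \<open>simp_all add: step_Sym\<close>)

lemma demazure_word_braid:
  assumes "braid N a b"
  shows "demazure_word N a = demazure_word N b"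
  using assms
proof cases
  case (long us vs i)
  have "foldr (lstep N) vs id \<in> Sym N" using long by (intro foldr_lstep_Sym) auto
  then show ?thesis using long by (simp add: demazure_word_foldr lstep_braid)
next
  case (comm us vs i j)
  have "foldr (lstep N) vs id \<in> Sym N" using comm by (intro foldr_lstep_Sym) auto
  then show ?thesis using comm lstep_commute[of i N j] by (simp add: demazure_word_foldr)
qed

lemma braid_words: "braid N a b \<Longrightarrow> a \<in> words N \<and> b \<in> words N \<and> length a = length b"
  by (auto elim!: braid.cases)

lemma initial_rel_words:
  "initial_rel n a b \<Longrightarrow> a \<in> words (2 * n) \<and> b \<in> words (2 * n) \<and> length a = length b"
  by (auto elim!: initial_rel.cases)

text \<open>For the arcs \<open>(i, j)\<close> and \<open>(Suc i, Suc j)\<close>, exchanging the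
  left ends or the right ends yields the same pair of nested arcs.\<close>

lemma fpf_conj_eq:
  assumes "fpf_involution N y" "y i = j" "y (Suc i) = Suc j" "Suc i < j"
  shows "fpf_conj i y = fpf_conj j y"
proof
  fix k
  note y = fpf_involutionD[OF assms(1)]
  have yj: "y j = i" "y (Suc j) = Suc i" using y(2) assms(2,3) by metis+
  consider "k = i" | "k = Suc i" | "k = j" | "k = Suc j"
    | "k \<notin> {i, Suc i, j, Suc j}" by blast
  then show "fpf_conj i y k = fpf_conj j y k"
  proof cases
    case 5
    then have "y k \<notin> {i, Suc i, j, Suc j}" using y(2)[of k] assms(2,3) yj by auto
    then show ?thesis using 5 by (simp add: fpf_conj_apply simple_apply)
  qed (use assms(2-4) yj in \<open>simp_all add: fpf_conj_apply simple_apply\<close>)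
qed

lemma fold_fpf_step_initial:
  assumes "initial_rel n a b"
  shows "fold fpf_step a (w_fpf n) = fold fpf_step b (w_fpf n)"
  using assms
proof cases
  case (1 vs i)
  define p where "p = 2 * i - 1"
  define w where "w = w_fpf n"
  have p: "2 * i - 1 = p" "2 * i = Suc p" "2 * i + 1 = Suc (Suc p)" "odd p"
    "p \<in> {1..2 * n}" "Suc (Suc (Suc p)) \<le> 2 * n"
    using 1(4,5) by (auto simp: p_def)
  have w: "w p = Suc p" "w (Suc p) = p" "w (Suc (Suc p)) = Suc (Suc (Suc p))"
    "w (Suc (Suc (Suc p))) = Suc (Suc p)"
    using p(4-6) by (auto simp: w_def w_fpf_apply)
  \<comment> \<open>The common first letter turns the arcs \<open>(p, p + 1)\<close>,
    \<open>(p + 2, p + 3)\<close> into \<open>(p, p + 2)\<close>, \<open>(p + 1, p + 3)\<close>, the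
    situation of \<open>fpf_conj_eq\<close>.\<close>
  define u where "u = fpf_conj (Suc p) w"
  have u: "u p = Suc (Suc p)" "u (Suc p) = Suc (Suc (Suc p))" "u (Suc (Suc p)) = p"
    "u (Suc (Suc (Suc p))) = Suc p"
    using w by (simp_all add: u_def fpf_conj_apply simple_apply)
  have "fpf_involution (2 * n) u"
    unfolding u_def w_def using p fpf_involution_w_fpf by (intro fpf_involution_conj) auto
  then have "fpf_conj p u = fpf_conj (Suc (Suc p)) u" using u by (intro fpf_conj_eq) auto
  moreover have "fpf_step (Suc p) w = u" using w by (simp add: fpf_step_def u_def)
  ultimately show ?thesis
    unfolding 1(1,2) p using u by (simp add: fpf_step_def flip: w_def)
qed

text \<open>Each relation keeps the number of letters and the endpoint, by the Demazure product for
  braid relations and by direct computation for the initial one. By \<open>fpf_path_if_len\<close>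
  this makes the new word a path.\<close>

lemma fpf_path_rel:
  assumes "fpf_path n a x" "braid (2 * n) a b \<or> initial_rel n a b \<or> braid (2 * n) b a \<or> initial_rel n b a"
  shows "fpf_path n b x"
proof -
  have l: "b \<in> words (2 * n)" "length b = length a"
    using assms(2) by (auto dest: braid_words initial_rel_words)
  note a = fpf_pathD[OF assms(1)]
  have "fold fpf_step b (w_fpf n) = fold fpf_step a (w_fpf n)"
  proof -
    have "fold fpf_step b (w_fpf n) = fold fpf_step a (w_fpf n)"
      if "demazure_word (2 * n) a = demazure_word (2 * n) b"
    proof -
      have "demazure_conj (2 * n) (w_fpf n) a = demazure_conj (2 * n) (w_fpf n) b"
        unfolding demazure_conj_def that ..
      then show ?thesis
        using demazure_conj_fold[OF _ fpf_involution_w_fpf] a(1) l(1) by simp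
    qed
    then show ?thesis using assms(2) fold_fpf_step_initial demazure_word_braid by metis
  qed
  then show ?thesis using fpf_path_if_len[OF l(1)] a l(2) by simp
qed

lemma fpf_path_equiv:
  assumes "fpf_path n a x" "(a, b) \<in> fpf_braid_equiv n"
  shows "fpf_path n b x"
proof -
  have "equivclp (\<lambda>a b. braid (2 * n) a b \<or> initial_rel n a b) a b"
    using assms(2) by (simp add: fpf_braid_equiv_def)
  then show ?thesis
    using assms(1) by (induction) (use fpf_path_rel in blast)+
qed

section \<open>Closure properties of the generated equivalence\<close>

lemma fpf_braid_equiv_refl: "a \<in> words (2 * n) \<Longrightarrow> (a, a) \<in> fpf_braid_equiv n"
  by (simp add: fpf_braid_equiv_def equivclp_refl)

lemma fpf_braid_equiv_sym: "(a, b) \<in> fpf_braid_equiv n \<Longrightarrow> (b, a) \<in> fpf_braid_equiv n"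
  by (auto simp: fpf_braid_equiv_def intro: equivclp_sym)

lemma fpf_braid_equiv_trans [trans]:
  "(a, b) \<in> fpf_braid_equiv n \<Longrightarrow> (b, c) \<in> fpf_braid_equiv n \<Longrightarrow> (a, c) \<in> fpf_braid_equiv n"
  by (auto simp: fpf_braid_equiv_def intro: equivclp_trans)

lemma fpf_braid_equiv_rel:
  "braid (2 * n) a b \<or> initial_rel n a b \<Longrightarrow> (a, b) \<in> fpf_braid_equiv n"
  using braid_words[of "2 * n" a b] initial_rel_words[of n a b]
  by (auto simp: fpf_braid_equiv_def intro: r_into_equivclp)

text \<open>Words are extended on the right only, since the initial relation is tied to the first
  two letters.\<close>

lemma rel_append:
  assumes "braid (2 * n) a b \<or> initial_rel n a b" "c \<in> words (2 * n)"
  shows "braid (2 * n) (a @ c) (b @ c) \<or> initial_rel n (a @ c) (b @ c)"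
proof -
  have "braid (2 * n) (a @ c) (b @ c)" if "braid (2 * n) a b"
    using that
  proof cases
    case (long us vs i)
    then show ?thesis using braid.long[of us "2 * n" "vs @ c" i] assms(2) by simp
  next
    case (comm us vs i j)
    then show ?thesis using braid.comm[of us "2 * n" "vs @ c" i j] assms(2) by simp
  qed
  moreover have "initial_rel n (a @ c) (b @ c)" if "initial_rel n a b"
    using that
  proof cases
    case (1 vs i)
    then show ?thesis using initial_rel.intros[of "vs @ c" n i] assms(2) by simp
  qed
  ultimately show ?thesis using assms(1) by blast
qed

lemma fpf_braid_equiv_append:
  assumes "(a, b) \<in> fpf_braid_equiv n" "c \<in> words (2 * n)"
  shows "(a @ c, b @ c) \<in> fpf_braid_equiv n"
proof -
  let ?r = "\<lambda>a b. braid (2 * n) a b \<or> initial_rel n a b"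
  have "equivclp ?r a b" using assms(1) by (simp add: fpf_braid_equiv_def)
  then have "equivclp ?r (a @ c) (b @ c)"
  proof induction
    case (step y z)
    then have "equivclp ?r (y @ c) (z @ c)"
      using rel_append[OF _ assms(2)]  by (metis (mono_tags, lifting) r_into_equivclp equivclp_sym)
    with step show ?case by (blast intro: equivclp_trans)
  qed (rule equivclp_refl)
  then show ?thesis using assms by (simp add: fpf_braid_equiv_def)
qed

lemma fpf_braid_equiv_comm:
  assumes "a \<in> words (2 * n)" "c \<in> words (2 * n)" "i \<in> {1..<2 * n}" "j \<in> {1..<2 * n}"
    "Suc i < j \<or> Suc j < i"
  shows "(a @ [i, j] @ c, a @ [j, i] @ c) \<in> fpf_braid_equiv n"
  using assms by (intro fpf_braid_equiv_rel disjI1 braid.comm) auto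

lemma fpf_braid_equiv_long:
  assumes "a \<in> words (2 * n)" "c \<in> words (2 * n)" "1 \<le> i" "Suc i < 2 * n"
  shows "(a @ [i, Suc i, i] @ c, a @ [Suc i, i, Suc i] @ c) \<in> fpf_braid_equiv n"
  using assms by (intro fpf_braid_equiv_rel disjI1 braid.long) auto

subsection \<open>Equivalence of paths\<close>

lemma fpf_braid_equiv_move:
  assumes "c \<in> words (2 * n)" "d \<in> words (2 * n)" "k \<in> {1..<2 * n}" "ts \<in> words (2 * n)"
    "\<forall>t \<in> set ts. Suc k < t \<or> Suc t < k"
  shows "(c @ [k] @ ts @ d, c @ ts @ [k] @ d) \<in> fpf_braid_equiv n"
  using assms(1,4,5)
proof (induction ts arbitrary: c)
  case Nil
  then show ?case using assms by (auto intro: fpf_braid_equiv_refl)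
next
  case (Cons t ts)
  have "(c @ [k, t] @ (ts @ d), c @ [t, k] @ (ts @ d)) \<in> fpf_braid_equiv n"
    using Cons.prems assms(2,3) by (intro fpf_braid_equiv_comm) auto
  moreover have "((c @ [t]) @ [k] @ ts @ d, (c @ [t]) @ ts @ [k] @ d) \<in> fpf_braid_equiv n"
    using Cons.prems by (intro Cons.IH) auto
  ultimately show ?case using fpf_braid_equiv_trans by fastforce
qed

text \<open>A letter passing leftwards through a descending run drops by one: a single braid
  relation does it, and commutations bring the letters into place. This transports words when a
  block of four points slides past an arc.\<close>

lemma fpf_braid_equiv_run_down:
  assumes "c \<in> words (2 * n)" "d \<in> words (2 * n)" "1 \<le> p" "Suc (Suc (Suc p)) < 2 * n"
    "k \<in> {p, Suc p, Suc (Suc p)}"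
  shows "(c @ [Suc (Suc (Suc p)), Suc (Suc p), Suc p, p, Suc k] @ d,
    c @ [k, Suc (Suc (Suc p)), Suc (Suc p), Suc p, p] @ d) \<in> fpf_braid_equiv n"
proof -
  let ?p1 = "Suc p" let ?p2 = "Suc ?p1" let ?p3 = "Suc ?p2"
  note mv = fpf_braid_equiv_move and lg = fpf_braid_equiv_long[THEN fpf_braid_equiv_sym]
  have r: "p \<in> {1..<2 * n}" "?p1 \<in> {1..<2 * n}" "?p2 \<in> {1..<2 * n}" "?p3 \<in> {1..<2 * n}"
    using assms by auto
  consider "k = p" | "k = ?p1" | "k = ?p2" using assms(5) by auto
  then show ?thesis
  proof cases
    case 1
    have "(c @ [?p3, ?p2, ?p1, p, ?p1] @ d, c @ [?p3, ?p2, p, ?p1, p] @ d) \<in> fpf_braid_equiv n"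
      using lg[of "c @ [?p3, ?p2]" n d p] assms r by simp
    also have "(c @ [?p3, ?p2, p, ?p1, p] @ d, c @ [p, ?p3, ?p2, ?p1, p] @ d) \<in> fpf_braid_equiv n"
      using mv[of c n "[?p1, p] @ d" p "[?p3, ?p2]", THEN fpf_braid_equiv_sym] assms r by auto
    finally show ?thesis using 1 by simp
  next
    case 2
    have "(c @ [?p3, ?p2, ?p1, p, ?p2] @ d, c @ [?p3, ?p2, ?p1, ?p2, p] @ d) \<in> fpf_braid_equiv n"
      using mv[of "c @ [?p3, ?p2, ?p1]" n d p "[?p2]"] assms r by auto
    also have "(c @ [?p3, ?p2, ?p1, ?p2, p] @ d, c @ [?p3, ?p1, ?p2, ?p1, p] @ d) \<in> fpf_braid_equiv n"
      using lg[of "c @ [?p3]" n "[p] @ d" ?p1] assms r by simp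
    also have "(c @ [?p3, ?p1, ?p2, ?p1, p] @ d, c @ [?p1, ?p3, ?p2, ?p1, p] @ d) \<in> fpf_braid_equiv n"
      using mv[of c n "[?p2, ?p1, p] @ d" ?p3 "[?p1]"] assms r by auto
    finally show ?thesis using 2 by simp
  next
    case 3
    have "(c @ [?p3, ?p2, ?p1, p, ?p3] @ d, c @ [?p3, ?p2, ?p3, ?p1, p] @ d) \<in> fpf_braid_equiv n"
      using mv[of "c @ [?p3, ?p2]" n d ?p3 "[?p1, p]", THEN fpf_braid_equiv_sym] assms r by auto
    also have "(c @ [?p3, ?p2, ?p3, ?p1, p] @ d, c @ [?p2, ?p3, ?p2, ?p1, p] @ d) \<in> fpf_braid_equiv n"
      using lg[of c n "[?p1, p] @ d" ?p2] assms r by simp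
    finally show ?thesis using 3 by simp
  qed
qed

text \<open>Mirror image of \<open>fpf_braid_equiv_run_down\<close>: through an ascending run the
  letter rises by one.\<close>

lemma fpf_braid_equiv_run_up:
  assumes "c \<in> words (2 * n)" "d \<in> words (2 * n)" "1 \<le> p" "Suc (Suc (Suc p)) < 2 * n"
    "k \<in> {p, Suc p, Suc (Suc p)}"
  shows "(c @ [p, Suc p, Suc (Suc p), Suc (Suc (Suc p)), k] @ d,
    c @ [Suc k, p, Suc p, Suc (Suc p), Suc (Suc (Suc p))] @ d) \<in> fpf_braid_equiv n"
proof -
  let ?p1 = "Suc p" let ?p2 = "Suc ?p1" let ?p3 = "Suc ?p2"
  note mv = fpf_braid_equiv_move and lg = fpf_braid_equiv_long
  have r: "p \<in> {1..<2 * n}" "?p1 \<in> {1..<2 * n}" "?p2 \<in> {1..<2 * n}" "?p3 \<in> {1..<2 * n}"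
    using assms by auto
  consider "k = p" | "k = ?p1" | "k = ?p2" using assms(5) by auto
  then show ?thesis
  proof cases
    case 1
    have "(c @ [p, ?p1, ?p2, ?p3, p] @ d, c @ [p, ?p1, p, ?p2, ?p3] @ d) \<in> fpf_braid_equiv n"
      using mv[of "c @ [p, ?p1]" n d p "[?p2, ?p3]", THEN fpf_braid_equiv_sym] assms r by auto
    also have "(c @ [p, ?p1, p, ?p2, ?p3] @ d, c @ [?p1, p, ?p1, ?p2, ?p3] @ d) \<in> fpf_braid_equiv n"
      using lg[of c n "[?p2, ?p3] @ d" p] assms r by simp
    finally show ?thesis using 1 by simp
  next
    case 2
    have "(c @ [p, ?p1, ?p2, ?p3, ?p1] @ d, c @ [p, ?p1, ?p2, ?p1, ?p3] @ d) \<in> fpf_braid_equiv n"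
      using mv[of "c @ [p, ?p1, ?p2]" n d ?p3 "[?p1]"] assms r by auto
    also have "(c @ [p, ?p1, ?p2, ?p1, ?p3] @ d, c @ [p, ?p2, ?p1, ?p2, ?p3] @ d) \<in> fpf_braid_equiv n"
      using lg[of "c @ [p]" n "[?p3] @ d" ?p1] assms r by simp
    also have "(c @ [p, ?p2, ?p1, ?p2, ?p3] @ d, c @ [?p2, p, ?p1, ?p2, ?p3] @ d) \<in> fpf_braid_equiv n"
      using mv[of c n "[?p1, ?p2, ?p3] @ d" p "[?p2]"] assms r by auto
    finally show ?thesis using 2 by simp
  next
    case 3
    have "(c @ [p, ?p1, ?p2, ?p3, ?p2] @ d, c @ [p, ?p1, ?p3, ?p2, ?p3] @ d) \<in> fpf_braid_equiv n"
      using lg[of "c @ [p, ?p1]" n d ?p2] assms r by simp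
    also have "(c @ [p, ?p1, ?p3, ?p2, ?p3] @ d, c @ [?p3, p, ?p1, ?p2, ?p3] @ d) \<in> fpf_braid_equiv n"
      using mv[of c n "[?p2, ?p3] @ d" ?p3 "[p, ?p1]", THEN fpf_braid_equiv_sym] assms r by auto
    finally show ?thesis using 3 by simp
  qed
qed

section \<open>Transporting the initial relation to arbitrary pairs of arcs\<close>

text \<open>Induction on the length of \<open>w\<close>. At \<open>w_fpf\<close> the initial
  relation applies to the empty path. Otherwise \<open>w\<close> has a usable descent
  \<open>k\<close>, which cannot lie inside the block \<open>{i,...,i+3}\<close>. If it is far from
  the block, its letter commutes with those in question; if it borders the block, four descents
  slide the block past a long arc.\<close>

lemma fpf_adjacent_arcs:
  assumes "fpf_involution (2 * n) w" "1 \<le> i" "Suc (Suc (Suc i)) \<le> 2 * n"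
    "w i = Suc i" "w (Suc (Suc i)) = Suc (Suc (Suc i))"
  shows "\<exists>c. fpf_path n c w \<and> (c @ [Suc i, i], c @ [Suc i, Suc (Suc i)]) \<in> fpf_braid_equiv n"
  using assms
proof (induction "len (2 * n) w" arbitrary: w i rule: less_induct)
  case less
  note w = fpf_involutionD[OF less.prems(1)] and wi = less.prems(4,5)
  have wi': "w (Suc i) = i" "w (Suc (Suc (Suc i))) = Suc (Suc i)" using w(2) wi by metis+
  have r: "i \<in> {1..<2 * n}" "Suc i \<in> {1..<2 * n}" "Suc (Suc i) \<in> {1..<2 * n}"
    using less.prems by auto
  show ?case
  proof (cases "w = w_fpf n")
    case True
    have "odd i" using wi less.prems(2,3) unfolding True by (auto simp: w_fpf_apply split: if_splits)
    then obtain m where m: "i = Suc (2 * m)" by (auto elim: oddE)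
    \<comment> \<open>With \<open>i = 2 * m + 1\<close>, the initial relation with index
      \<open>m + 1\<close> has first letter \<open>2 * (m + 1) = Suc i\<close>.\<close>
    have "([Suc i, i], [Suc i, Suc (Suc i)]) \<in> fpf_braid_equiv n"
      using initial_rel.intros[of "[]" n "Suc m"] less.prems(3) m
      by (intro fpf_braid_equiv_rel disjI2) simp
    then show ?thesis using fpf_path.Nil True by (intro exI[of _ "[]"]) simp
  next
    case False
    then obtain k where k: "k \<in> {1..<2 * n}" "w (Suc k) < w k" "w k \<noteq> Suc k"
      using fpf_descent_exists[OF less.prems(1)] by blast
    have "k \<noteq> i" "k \<noteq> Suc i" "k \<noteq> Suc (Suc i)" using k wi wi' by auto
    then consider "Suc k < i \<or> Suc (Suc (Suc i)) < k" | "i = Suc k" | "k = Suc (Suc (Suc i))" by linarith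
    then show ?thesis
    proof cases
      case 1
      note d = fpf_descent[OF less.prems(1) k]
      have "fpf_conj k w i = Suc i" "fpf_conj k w (Suc (Suc i)) = Suc (Suc (Suc i))"
        using 1 wi by (auto simp: fpf_conj_apply simple_apply)
      then obtain c where c: "fpf_path n c (fpf_conj k w)"
        "(c @ [Suc i, i], c @ [Suc i, Suc (Suc i)]) \<in> fpf_braid_equiv n"
        using less.hyps[OF d(3,1) less.prems(2,3)] by blast
      note cw = fpf_pathD(1)[OF c(1)]
      have "(c @ [k] @ [Suc i, i] @ [], c @ [Suc i, i] @ [k] @ []) \<in> fpf_braid_equiv n"
        using cw k r 1 by (intro fpf_braid_equiv_move) auto
      also have "(c @ [Suc i, i] @ [k] @ [], c @ [Suc i, Suc (Suc i)] @ [k] @ []) \<in> fpf_braid_equiv n"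
        using fpf_braid_equiv_append[OF c(2), of "[k]"] k by simp
      also have "(c @ [Suc i, Suc (Suc i)] @ [k] @ [], c @ [k] @ [Suc i, Suc (Suc i)] @ [])
          \<in> fpf_braid_equiv n"
        using cw k r 1 by (intro fpf_braid_equiv_move[THEN fpf_braid_equiv_sym]) auto
      finally show ?thesis
        using fpf_path_descent[OF less.prems(1) k c(1)] by (intro exI[of _ "c @ [k]"]) simp
    next
      case 2
      \<comment> \<open>move the block one position to the left, past the long arc starting at \<open>k\<close>\<close>
      let ?k1 = "Suc k" let ?k2 = "Suc ?k1" let ?k3 = "Suc ?k2" let ?k4 = "Suc ?k3"
      define q where "q = w k"
      have v: "w ?k1 = ?k2" "w ?k2 = ?k1" "w ?k3 = ?k4" "w ?k4 = ?k3" using wi wi' 2 by auto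
      have "q \<noteq> ?k3" "q \<noteq> ?k4" using w(2)[of k] v by (auto simp: q_def)
      \<comment> \<open>The descent at \<open>k\<close> gives \<open>q > w ?k1 = ?k2\<close>, and
        \<open>?k3\<close>, \<open>?k4\<close> are matched with each other.\<close>
      then have q: "?k4 < q" using k(2) v by (simp add: q_def)
      \<comment> \<open>Successive descents push the left end of the arc from \<open>k\<close> to
        \<open>?k4\<close>, so that \<open>w4\<close> has the block at
        \<open>k, ..., ?k3\<close>.\<close>
      define w1 w2 w3 w4 where "w1 = fpf_conj k w" "w2 = fpf_conj ?k1 w1" "w3 = fpf_conj ?k2 w2"
        "w4 = fpf_conj ?k3 w3"
      note ws = this
      have v1: "w1 ?k1 = q" "w1 ?k2 = k" "w1 k = ?k2" "w1 ?k3 = ?k4" "w1 ?k4 = ?k3"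
        using v q by (simp_all add: ws(1) fpf_conj_apply simple_apply q_def)
      have v2: "w2 ?k2 = q" "w2 k = ?k1" "w2 ?k1 = k" "w2 ?k3 = ?k4" "w2 ?k4 = ?k3"
        using v1 q by (simp_all add: ws(2) fpf_conj_apply simple_apply)
      have v3: "w3 ?k3 = q" "w3 k = ?k1" "w3 ?k1 = k" "w3 ?k2 = ?k4" "w3 ?k4 = ?k2"
        using v2 q by (simp_all add: ws(3) fpf_conj_apply simple_apply)
      have v4: "w4 k = ?k1" "w4 ?k2 = ?k3"
        using v3 q by (simp_all add: ws(4) fpf_conj_apply simple_apply)
      have r': "?k1 \<in> {1..<2 * n}" "?k2 \<in> {1..<2 * n}" "?k3 \<in> {1..<2 * n}" using r 2 by auto
      note d1 = fpf_descent[OF less.prems(1) k, folded ws]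
      have k1: "w1 ?k2 < w1 ?k1" "w1 ?k1 \<noteq> ?k2" using v1 q by auto
      note d2 = fpf_descent[OF d1(1) r'(1) k1, folded ws]
      have k2: "w2 ?k3 < w2 ?k2" "w2 ?k2 \<noteq> ?k3" using v2 q by auto
      note d3 = fpf_descent[OF d2(1) r'(2) k2, folded ws]
      have k3: "w3 ?k4 < w3 ?k3" "w3 ?k3 \<noteq> ?k4" using v3 q by auto
      note d4 = fpf_descent[OF d3(1) r'(3) k3, folded ws]
      have k': "1 \<le> k" "?k3 < 2 * n" using k(1) r' by auto
      obtain c where c: "fpf_path n c w4" "(c @ [?k1, k], c @ [?k1, ?k2]) \<in> fpf_braid_equiv n"
        using less.hyps[OF _ d4(1) k'(1) _ v4] d1(3) d2(3) d3(3) d4(3) k'(2) by auto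
      note cw = fpf_pathD(1)[OF c(1)]
      have "fpf_path n (c @ [?k3]) w3"
        using fpf_path_descent[OF d3(1) r'(3) k3] c(1) by (simp add: ws)
      then have "fpf_path n ((c @ [?k3]) @ [?k2]) w2"
        using fpf_path_descent[OF d2(1) r'(2) k2] by (simp only: ws)
      then have "fpf_path n (((c @ [?k3]) @ [?k2]) @ [?k1]) w1"
        using fpf_path_descent[OF d1(1) r'(1) k1] by (simp only: ws)
      then have "fpf_path n ((((c @ [?k3]) @ [?k2]) @ [?k1]) @ [k]) w"
        using fpf_path_descent[OF less.prems(1) k] by (simp only: ws)
      then have path: "fpf_path n (c @ [?k3, ?k2, ?k1, k]) w" by simp
      note run = fpf_braid_equiv_run_down[OF _ _ k']
      \<comment> \<open>Both letters after the run drop by one in passing it; \<open>l = k\<close>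
        and \<open>l = ?k2\<close> give the two words that the induction hypothesis relates.\<close>
      have D: "(c @ [?k3, ?k2, ?k1, k] @ [?k2, Suc l], c @ [?k1, l] @ [?k3, ?k2, ?k1, k])
          \<in> fpf_braid_equiv n" if "l = k \<or> l = ?k2" for l
      proof -
        have "(c @ [?k3, ?k2, ?k1, k, ?k2] @ [Suc l], c @ [?k1, ?k3, ?k2, ?k1, k] @ [Suc l])
            \<in> fpf_braid_equiv n"
          using that cw r' k by (intro run) auto
        also have "(c @ [?k1, ?k3, ?k2, ?k1, k] @ [Suc l], c @ [?k1, l, ?k3, ?k2, ?k1, k])
            \<in> fpf_braid_equiv n"
          using run[of "c @ [?k1]" "[]" l] that cw r' by auto
        finally show ?thesis by simp
      qed
      have "(c @ [?k3, ?k2, ?k1, k] @ [?k2, ?k1], c @ [?k1, k] @ [?k3, ?k2, ?k1, k])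
          \<in> fpf_braid_equiv n" using D by blast
      also have "(c @ [?k1, k] @ [?k3, ?k2, ?k1, k], c @ [?k1, ?k2] @ [?k3, ?k2, ?k1, k])
          \<in> fpf_braid_equiv n"
        using fpf_braid_equiv_append[OF c(2), of "[?k3, ?k2, ?k1, k]"] k r' by simp
      also have "(c @ [?k1, ?k2] @ [?k3, ?k2, ?k1, k], c @ [?k3, ?k2, ?k1, k] @ [?k2, ?k3])
          \<in> fpf_braid_equiv n" using D fpf_braid_equiv_sym by blast
      finally show ?thesis using path 2 by (intro exI[of _ "c @ [?k3, ?k2, ?k1, k]"]) simp
    next
      case 3
      \<comment> \<open>move the block one position to the right, past the long arc ending at \<open>i + 4\<close>\<close>
      let ?i1 = "Suc i" let ?i2 = "Suc ?i1" let ?i3 = "Suc ?i2" let ?i4 = "Suc ?i3"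
      define q where "q = w ?i4"
      have "q \<noteq> i" "q \<noteq> ?i1" using w(2)[of ?i4] wi wi' by (auto simp: q_def)
      then have q: "q < i" using k(2) wi' 3 by (simp add: q_def)
      define w1 w2 w3 w4 where "w1 = fpf_conj ?i3 w" "w2 = fpf_conj ?i2 w1" "w3 = fpf_conj ?i1 w2"
        "w4 = fpf_conj i w3"
      note ws = this
      have v1: "w1 ?i3 = q" "w1 ?i2 = ?i4" "w1 ?i4 = ?i2" "w1 i = ?i1" "w1 ?i1 = i"
        using wi wi' q by (simp_all add: ws(1) fpf_conj_apply simple_apply q_def)
      have v2: "w2 ?i2 = q" "w2 ?i3 = ?i4" "w2 ?i4 = ?i3" "w2 i = ?i1" "w2 ?i1 = i"
        using v1 q by (simp_all add: ws(2) fpf_conj_apply simple_apply)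
      have v3: "w3 ?i1 = q" "w3 ?i3 = ?i4" "w3 ?i4 = ?i3" "w3 i = ?i2" "w3 ?i2 = i"
        using v2 q by (simp_all add: ws(3) fpf_conj_apply simple_apply)
      have v4: "w4 ?i1 = ?i2" "w4 ?i3 = ?i4"
        using v3 q by (simp_all add: ws(4) fpf_conj_apply simple_apply)
      have r': "?i3 \<in> {1..<2 * n}" using k 3 by simp
      have k0: "w ?i4 < w ?i3" "w ?i3 \<noteq> ?i4" using k 3 by auto
      note d1 = fpf_descent[OF less.prems(1) r' k0, folded ws]
      have k1: "w1 ?i3 < w1 ?i2" "w1 ?i2 \<noteq> ?i3" using v1 q by auto
      note d2 = fpf_descent[OF d1(1) r(3) k1, folded ws]
      have k2: "w2 ?i2 < w2 ?i1" "w2 ?i1 \<noteq> ?i2" using v2 q by auto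
      note d3 = fpf_descent[OF d2(1) r(2) k2, folded ws]
      have k3: "w3 ?i1 < w3 i" "w3 i \<noteq> ?i1" using v3 q by auto
      note d4 = fpf_descent[OF d3(1) r(1) k3, folded ws]
      have i': "1 \<le> i" "?i3 < 2 * n" using r r' by auto
      obtain c where c: "fpf_path n c w4" "(c @ [?i2, ?i1], c @ [?i2, ?i3]) \<in> fpf_braid_equiv n"
        using less.hyps[OF _ d4(1) _ _ v4] d1(3) d2(3) d3(3) d4(3) i' by auto
      note cw = fpf_pathD(1)[OF c(1)]
      have "fpf_path n (c @ [i]) w3"
        using fpf_path_descent[OF d3(1) r(1) k3] c(1) by (simp add: ws)
      then have "fpf_path n ((c @ [i]) @ [?i1]) w2"
        using fpf_path_descent[OF d2(1) r(2) k2] by (simp only: ws)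
      then have "fpf_path n (((c @ [i]) @ [?i1]) @ [?i2]) w1"
        using fpf_path_descent[OF d1(1) r(3) k1] by (simp only: ws)
      then have "fpf_path n ((((c @ [i]) @ [?i1]) @ [?i2]) @ [?i3]) w"
        using fpf_path_descent[OF less.prems(1) r' k0] by (simp only: ws)
      then have path: "fpf_path n (c @ [i, ?i1, ?i2, ?i3]) w" by simp
      note run = fpf_braid_equiv_run_up[OF _ _ i']
      have D: "(c @ [i, ?i1, ?i2, ?i3] @ [?i1, l], c @ [?i2, Suc l] @ [i, ?i1, ?i2, ?i3])
          \<in> fpf_braid_equiv n" if "l = i \<or> l = ?i2" for l
      proof -
        have "(c @ [i, ?i1, ?i2, ?i3, ?i1] @ [l], c @ [?i2, i, ?i1, ?i2, ?i3] @ [l])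
            \<in> fpf_braid_equiv n"
          using that cw r by (intro run) auto
        also have "(c @ [?i2, i, ?i1, ?i2, ?i3] @ [l], c @ [?i2, Suc l, i, ?i1, ?i2, ?i3])
            \<in> fpf_braid_equiv n"
          using run[of "c @ [?i2]" "[]" l] that cw r by auto
        finally show ?thesis by simp
      qed
      have "(c @ [i, ?i1, ?i2, ?i3] @ [?i1, i], c @ [?i2, ?i1] @ [i, ?i1, ?i2, ?i3])
          \<in> fpf_braid_equiv n" using D by blast
      also have "(c @ [?i2, ?i1] @ [i, ?i1, ?i2, ?i3], c @ [?i2, ?i3] @ [i, ?i1, ?i2, ?i3])
          \<in> fpf_braid_equiv n"
        using fpf_braid_equiv_append[OF c(2), of "[i, ?i1, ?i2, ?i3]"] r r' by simp
      also have "(c @ [?i2, ?i3] @ [i, ?i1, ?i2, ?i3], c @ [i, ?i1, ?i2, ?i3] @ [?i1, ?i2])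
          \<in> fpf_braid_equiv n" using D fpf_braid_equiv_sym by blast
      finally show ?thesis using path by (intro exI[of _ "c @ [i, ?i1, ?i2, ?i3]"]) simp
    qed
  qed
qed

text \<open>Induction on the length of \<open>y\<close>. If \<open>j = i + 2\<close>, the descent at
  \<open>Suc i\<close> makes the two arcs adjacent. Otherwise two descents move the left ends to the
  right or the right ends to the left, or there is a descent strictly between the ends, whose letter
  commutes with \<open>i\<close> and \<open>j\<close>.\<close>

lemma fpf_shifted_arcs:
  assumes "fpf_involution (2 * n) y" "i \<in> {1..<2 * n}" "j \<in> {1..<2 * n}" "Suc i < j"
    "y i = j" "y (Suc i) = Suc j"
  shows "\<exists>a. fpf_path n a y \<and> (a @ [i], a @ [j]) \<in> fpf_braid_equiv n"
  using assms
proof (induction "len (2 * n) y" arbitrary: y i j rule: less_induct)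
  case less
  note y = fpf_involutionD[OF less.prems(1)] and yi = less.prems(5,6) and r = less.prems(2,3)
  have yj: "y j = i" "y (Suc j) = Suc i" using y(2) yi by metis+
  let ?i1 = "Suc i" let ?i2 = "Suc ?i1" let ?j1 = "Suc j"
  have r1: "?i1 \<in> {1..<2 * n}" using r less.prems(4) by auto
  show ?case
  proof (cases "j = ?i2")
    case True
    have d: "y ?i2 < y ?i1" "y ?i1 \<noteq> ?i2" using True yi yj by auto
    note f = fpf_descent[OF less.prems(1) r1 d]
    define w where "w = fpf_conj ?i1 y"
    have w: "w i = ?i1" "w ?i2 = Suc ?i2"
      using True yi yj by (simp_all add: w_def fpf_conj_apply simple_apply)
    obtain c where c: "fpf_path n c w" "(c @ [?i1, i], c @ [?i1, ?i2]) \<in> fpf_braid_equiv n"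
      using fpf_adjacent_arcs[OF f(1)[folded w_def] _ _ w] r True by auto
    show ?thesis using fpf_path_descent[OF less.prems(1) r1 d] c True
      by (intro exI[of _ "c @ [?i1]"]) (simp add: w_def)
  next
    case ne: False
    then have j: "?i2 < j" using less.prems(4) by simp
    define j0 where "j0 = j - 1"
    have j0: "j = Suc j0" "?i1 < j0" using j by (auto simp: j0_def)
    have r2: "j0 \<in> {1..<2 * n}" using j0 r by auto
    have ne: "y k \<notin> {i, ?i1, j, ?j1}" if "k \<notin> {i, ?i1, j, ?j1}" for k
      using that y(2)[of k] yi yj by auto
    consider "y ?i2 < j" | "?i1 < y j0" | "?j1 < y ?i2" "y j0 < i"
      using ne[of ?i2] ne[of j0] j j0 by fastforce
    then show ?thesis
    proof cases
      case 1
      define p where "p = y ?i2"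
      have p: "p < j" "p \<noteq> ?i1" "p \<noteq> i" "p \<noteq> ?i2" using 1 ne[of ?i2] j y(5)[of ?i2] r
        by (auto simp: p_def)
      define w1 w2 where "w1 = fpf_conj ?i1 y" "w2 = fpf_conj i w1"
      note ws = this
      have v1: "w1 i = j" "w1 ?i1 = p" "w1 ?i2 = ?j1"
        using yi j p by (simp_all add: ws(1) fpf_conj_apply simple_apply p_def)
      have v2: "w2 ?i1 = j" "w2 ?i2 = ?j1"
        using v1 j by (simp_all add: ws(2) fpf_conj_apply simple_apply)
      have d1: "y ?i2 < y ?i1" "y ?i1 \<noteq> ?i2" using 1 yi j by auto
      note f1 = fpf_descent[OF less.prems(1) r1 d1, folded ws]
      have d2: "w1 ?i1 < w1 i" "w1 i \<noteq> ?i1" using v1 p j by auto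
      note f2 = fpf_descent[OF f1(1) r(1) d2, folded ws]
      obtain c where c: "fpf_path n c w2" "(c @ [?i1], c @ [j]) \<in> fpf_braid_equiv n"
        using less.hyps[OF _ f2(1) r1 r(2) j v2] f1(3) f2(3) by auto
      note cw = fpf_pathD(1)[OF c(1)]
      have "fpf_path n (c @ [i]) w1"
        using fpf_path_descent[OF f1(1) r(1) d2] c(1) by (simp only: ws)
      then have path: "fpf_path n ((c @ [i]) @ [?i1]) y"
        using fpf_path_descent[OF less.prems(1) r1 d1] by (simp only: ws)
      \<comment> \<open>The braid relation puts \<open>?i1\<close> directly after \<open>c\<close>,
        where the induction hypothesis replaces it by \<open>j\<close>; then \<open>j\<close>
        commutes to the end.\<close>
      have "(c @ [i, ?i1, i], c @ [?i1, i, ?i1]) \<in> fpf_braid_equiv n"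
        using fpf_braid_equiv_long[of c n "[]" i] cw r r1 by simp
      also have "(c @ [?i1, i, ?i1], c @ [j, i, ?i1]) \<in> fpf_braid_equiv n"
        using fpf_braid_equiv_append[OF c(2), of "[i, ?i1]"] r r1 by simp
      also have "(c @ [j, i, ?i1], c @ [i, ?i1, j]) \<in> fpf_braid_equiv n"
        using fpf_braid_equiv_move[of c n "[]" j "[i, ?i1]"] cw r r1 j by simp
      finally show ?thesis using path by (intro exI[of _ "c @ [i, ?i1]"]) simp
    next
      case 2
      define p where "p = y j0"
      have p: "?i1 < p" "p \<noteq> j" "p \<noteq> ?j1" "p \<noteq> j0" using 2 ne[of j0] j0 y(5)[of j0] r2
        by (auto simp: p_def)
      define w1 w2 where "w1 = fpf_conj j0 y" "w2 = fpf_conj j w1"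
      note ws = this
      have v1: "w1 j0 = i" "w1 j = p" "w1 ?j1 = ?i1" "w1 i = j0" "w1 ?i1 = ?j1"
        using yi yj j0 p by (simp_all add: ws(1) fpf_conj_apply simple_apply p_def)
      have v2: "w2 i = j0" "w2 ?i1 = Suc j0"
        using v1 j0 by (simp_all add: ws(2) fpf_conj_apply simple_apply)
      have d1: "y (Suc j0) < y j0" "y j0 \<noteq> Suc j0" using 2 yj p j0 by (auto simp: p_def)
      note f1 = fpf_descent[OF less.prems(1) r2 d1, folded ws]
      have d2: "w1 ?j1 < w1 j" "w1 j \<noteq> ?j1" using v1 p by auto
      note f2 = fpf_descent[OF f1(1) r(2) d2, folded ws]
      obtain c where c: "fpf_path n c w2" "(c @ [i], c @ [j0]) \<in> fpf_braid_equiv n"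
        using less.hyps[OF _ f2(1) r(1) r2 j0(2) v2] f1(3) f2(3) by auto
      note cw = fpf_pathD(1)[OF c(1)]
      have "fpf_path n (c @ [j]) w1"
        using fpf_path_descent[OF f1(1) r(2) d2] c(1) by (simp only: ws)
      then have path: "fpf_path n ((c @ [j]) @ [j0]) y"
        using fpf_path_descent[OF less.prems(1) r2 d1] by (simp only: ws)
      have "(c @ [j, j0, i], c @ [i, j, j0]) \<in> fpf_braid_equiv n"
        using fpf_braid_equiv_move[of c n "[]" i "[j, j0]", THEN fpf_braid_equiv_sym] cw r r2 j0
        by simp
      also have "(c @ [i, j, j0], c @ [j0, j, j0]) \<in> fpf_braid_equiv n"
        using fpf_braid_equiv_append[OF c(2), of "[j, j0]"] r r2 by simp
      also have "(c @ [j0, j, j0], c @ [j, j0, j]) \<in> fpf_braid_equiv n"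
        using fpf_braid_equiv_long[of c n "[]" j0] cw r r2 j0 by simp
      finally show ?thesis using path by (intro exI[of _ "c @ [j, j0]"]) simp
    next
      case 3
      \<comment> \<open>The values start above \<open>j\<close> at \<open>?i2\<close> and end below
        \<open>i\<close> at \<open>j0\<close>. A value above \<open>j\<close> at a position
        \<open>k\<close> with \<open>Suc k < j\<close> cannot be \<open>Suc k\<close>, so the drop
        is a usable descent.\<close>
      have "\<exists>k. ?i2 \<le> k \<and> Suc k < j \<and> y (Suc k) < y k \<and> y k \<noteq> Suc k"
      proof (rule ccontr)
        assume no: "\<nexists>k. ?i2 \<le> k \<and> Suc k < j \<and> y (Suc k) < y k \<and> y k \<noteq> Suc k"
        have "k < j \<longrightarrow> j < y k" if "?i2 \<le> k" for k
          using that
        proof (induction k rule: dec_induct)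
          case base
          then show ?case using 3 by simp
        next
          case (step k)
          show ?case
          proof
            assume kj: "Suc k < j"
            then have "j < y k" using step by simp
            moreover have "y k \<le> y (Suc k)"
              using no step(1) kj \<open>j < y k\<close> not_less by (metis less_asym)
            ultimately show "j < y (Suc k)" by linarith
          qed
        qed
        from this[of j0] show False using j0 3 by auto
      qed
      then obtain k where k: "?i2 \<le> k" "Suc k < j" "y (Suc k) < y k" "y k \<noteq> Suc k" by blast
      have rk: "k \<in> {1..<2 * n}" using k r by auto
      note f = fpf_descent[OF less.prems(1) rk k(3,4)]
      have "fpf_conj k y i = j" "fpf_conj k y ?i1 = ?j1"
        using k yi by (auto simp: fpf_conj_apply simple_apply)
      then obtain c where c: "fpf_path n c (fpf_conj k y)" "(c @ [i], c @ [j]) \<in> fpf_braid_equiv n"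
        using less.hyps[OF f(3,1) less.prems(2-4)] by blast
      note cw = fpf_pathD(1)[OF c(1)]
      have "(c @ [k, i], c @ [i, k]) \<in> fpf_braid_equiv n"
        using fpf_braid_equiv_comm[of c n "[]" k i] cw r rk k by simp
      also have "(c @ [i, k], c @ [j, k]) \<in> fpf_braid_equiv n"
        using fpf_braid_equiv_append[OF c(2), of "[k]"] rk by simp
      also have "(c @ [j, k], c @ [k, j]) \<in> fpf_braid_equiv n"
        using fpf_braid_equiv_comm[of c n "[]" j k] cw r rk k by simp
      finally show ?thesis
        using fpf_path_descent[OF less.prems(1) rk k(3,4) c(1)] by (intro exI[of _ "c @ [k]"]) simp
    qed
  qed
qed

section \<open>Comparing two paths by their last letters\<close>

lemma fpf_conj_braid:
  "fpf_conj i (fpf_conj (Suc i) (fpf_conj i y)) = fpf_conj (Suc i) (fpf_conj i (fpf_conj (Suc i) y))"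
proof -
  have "simple i (simple (Suc i) (simple i k)) = simple (Suc i) (simple i (simple (Suc i) k))" for k
    by (auto simp: simple_apply)
  then show ?thesis by (simp add: fun_eq_iff fpf_conj_apply)
qed

lemma fpf_conj_commute:
  assumes "Suc i < j"
  shows "fpf_conj i (fpf_conj j y) = fpf_conj j (fpf_conj i y)"
proof -
  have "simple i (simple j k) = simple j (simple i k)" for k
    using assms by (auto simp: simple_apply)
  then show ?thesis by (simp add: fun_eq_iff fpf_conj_apply)
qed

lemma fpf_conj_descent:
  assumes "fpf_involution N y" "i \<in> {1..<N}" "y i < y (Suc i)"
  shows "fpf_conj i y (Suc i) < fpf_conj i y i" "fpf_conj i y i \<noteq> Suc i"
  using fpf_ascent_notin[OF assms] assms(3) by (auto simp: fpf_conj_apply simple_apply)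

text \<open>The inductive step for final letters \<open>i < j\<close>. The induction hypothesis
  \<open>IH\<close> allows \<open>a\<close> and \<open>b\<close> to be replaced by any paths to
  \<open>y\<close> and \<open>z\<close>; these are chosen through a common lower involution
  \<open>v\<close>, or, for nested arcs, as one path to \<open>y = z\<close>.\<close>

lemma fpf_path_equiv_step:
  assumes IH: "\<And>c d v. fpf_path n c v \<Longrightarrow> fpf_path n d v \<Longrightarrow> length c = length a \<Longrightarrow>
      (c, d) \<in> fpf_braid_equiv n"
    and a: "fpf_path n a y" "i \<in> {1..<2 * n}" "y i < y (Suc i)" "x = fpf_conj i y"
    and b: "fpf_path n b z" "j \<in> {1..<2 * n}" "z j < z (Suc j)" "x = fpf_conj j z"
    and "i < j"
  shows "(a @ [i], b @ [j]) \<in> fpf_braid_equiv n"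
proof -
  note ya = fpf_pathD[OF a(1)] and zb = fpf_pathD[OF b(1)]
  have x: "fpf_involution (2 * n) x" using fpf_involution_conj[OF ya(2) a(2)] a(4) by simp
  note xx = fpf_involutionD[OF x]
  have y_eq: "y = fpf_conj i x" and z_eq: "z = fpf_conj j x"
    using a(4) b(4) fpf_conj_fpf_conj by metis+
  have di: "x (Suc i) < x i" "x i \<noteq> Suc i" using fpf_conj_descent[OF ya(2) a(2,3)] a(4) by simp_all
  have dj: "x (Suc j) < x j" "x j \<noteq> Suc j" using fpf_conj_descent[OF zb(2) b(2,3)] b(4) by simp_all
  have "len (2 * n) y + 2 = len (2 * n) z + 2"
    using fpf_conj_steps(2)[OF ya(2) a(2,3)] fpf_conj_steps(2)[OF zb(2) b(2,3)] a(4) b(4) by simp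
  then have lab: "length b = length a" using ya(3) zb(3) by simp
  have app: "(c @ [k], d @ [k]) \<in> fpf_braid_equiv n"
    if "fpf_path n c v" "fpf_path n d v" "length c = length a" "k \<in> {1..<2 * n}" for c d v k
    using fpf_braid_equiv_append[OF IH[OF that(1-3)], of "[k]"] that(4) by simp
  have len_eq: "length c = length d" if "fpf_path n c v" "fpf_path n d v" for c d v
    using fpf_pathD(3)[OF that(1)] fpf_pathD(3)[OF that(2)] by simp
  show ?thesis
  proof (cases "j = Suc i")
    case True
    let ?i1 = "Suc i" let ?i2 = "Suc ?i1"
    have r1: "?i1 \<in> {1..<2 * n}" using True b(2) by simp
    have d1: "x ?i2 < x ?i1" "x ?i1 \<noteq> ?i2" using dj True by simp_all
    have fp: "x i \<noteq> i" "x ?i1 \<noteq> ?i1" "x ?i2 \<noteq> ?i2"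
      using xx(5)[of i] xx(5)[of ?i1] xx(5)[of ?i2] a(2) r1 by auto
    \<comment> \<open>Otherwise the decreasing values \<open>x i\<close>, \<open>x ?i1\<close>,
      \<open>x ?i2\<close> start at \<open>?i2\<close> and end at \<open>i\<close>, making
      \<open>?i1\<close> a fixed point.\<close>
    have "x i \<noteq> ?i2"
    proof
      assume *: "x i = ?i2"
      then have "x ?i2 = i" using xx(2) by metis
      then show False using * di d1 fp by linarith
    qed
    then have nx: "x i \<noteq> i" "x i \<noteq> ?i1" "x i \<noteq> ?i2" "x ?i1 \<noteq> i" "x ?i1 \<noteq> ?i1" "x ?i1 \<noteq> ?i2"
      "x ?i2 \<noteq> i" "x ?i2 \<noteq> ?i1" "x ?i2 \<noteq> ?i2"
      using fp di(2) d1(2) xx(2) by metis+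
    \<comment> \<open>The two sides of a hexagon below \<open>x\<close>: \<open>x\<close>,
      \<open>y\<close>, \<open>y1\<close>, \<open>v\<close> along \<open>i\<close>,
      \<open>?i1\<close>, \<open>i\<close>, and \<open>x\<close>, \<open>z\<close>,
      \<open>z1\<close>, \<open>v\<close> along \<open>?i1\<close>, \<open>i\<close>,
      \<open>?i1\<close>.\<close>
    define y1 z1 v where "y1 = fpf_conj ?i1 y" "z1 = fpf_conj i z" "v = fpf_conj i y1"
    note ws = this
    have v': "v = fpf_conj ?i1 z1"
      unfolding ws y_eq z_eq True by (rule fpf_conj_braid)
    have vy: "y i = x ?i1" "y ?i1 = x i" "y ?i2 = x ?i2"
      using nx by (simp_all add: y_eq fpf_conj_apply simple_apply)
    have vy1: "y1 i = x ?i1" "y1 ?i1 = x ?i2" "y1 ?i2 = x i"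
      using nx vy by (simp_all add: ws(1) fpf_conj_apply simple_apply)
    have vz: "z i = x i" "z ?i1 = x ?i2" "z ?i2 = x ?i1"
      using nx by (simp_all add: z_eq True fpf_conj_apply simple_apply)
    have vz1: "z1 i = x ?i2" "z1 ?i1 = x i" "z1 ?i2 = x ?i1"
      using nx vz by (simp_all add: ws(2) fpf_conj_apply simple_apply)
    have e1: "y ?i2 < y ?i1" "y ?i1 \<noteq> ?i2" using vy nx di d1 by auto
    note f1 = fpf_descent[OF ya(2) r1 e1, folded ws]
    have e2: "y1 ?i1 < y1 i" "y1 i \<noteq> ?i1" using vy1 nx di d1 by auto
    note f2 = fpf_descent[OF f1(1) a(2) e2, folded ws]
    have e3: "z ?i1 < z i" "z i \<noteq> ?i1" using vz nx di d1 by auto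
    note f3 = fpf_descent[OF zb(2) a(2) e3, folded ws]
    have e4: "z1 ?i2 < z1 ?i1" "z1 ?i1 \<noteq> ?i2" using vz1 nx di d1 by auto
    obtain c where c: "fpf_path n c v" using fpf_path_exists[OF f2(1)] by blast
    note cw = fpf_pathD(1)[OF c]
    have "fpf_path n (c @ [i]) y1" using fpf_path_descent[OF f1(1) a(2) e2] c by (simp only: ws)
    then have py: "fpf_path n ((c @ [i]) @ [?i1]) y"
      using fpf_path_descent[OF ya(2) r1 e1] by (simp only: ws)
    have "fpf_path n (c @ [?i1]) z1" using fpf_path_descent[OF f3(1) r1 e4] c by (simp only: v')
    then have pz: "fpf_path n ((c @ [?i1]) @ [i]) z"
      using fpf_path_descent[OF zb(2) a(2) e3] by (simp only: ws)
    have "(a @ [i], ((c @ [i]) @ [?i1]) @ [i]) \<in> fpf_braid_equiv n"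
      using app[OF a(1) py _ a(2)] by simp
    also have "(((c @ [i]) @ [?i1]) @ [i], ((c @ [?i1]) @ [i]) @ [?i1]) \<in> fpf_braid_equiv n"
      using fpf_braid_equiv_long[of c n "[]" i] cw a(2) r1 by simp
    also have "(((c @ [?i1]) @ [i]) @ [?i1], b @ [?i1]) \<in> fpf_braid_equiv n"
      using app[OF pz b(1) _ r1] len_eq[OF pz b(1)] lab by simp
    finally show ?thesis using True by simp
  next
    case False
    then have ij: "Suc i < j" using \<open>i < j\<close> by simp
    show ?thesis
    \<comment> \<open>Only for these nested arcs does the descent at \<open>i\<close> destroy the
      one at \<open>j\<close>: \<open>simple i\<close> reverses the order of two values only if they
      are \<open>i\<close> and \<open>Suc i\<close>.\<close>
    proof (cases "x j = Suc i \<and> x (Suc j) = i")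
      case True
      then have xi: "x (Suc i) = j" "x i = Suc j" using xx(2) by metis+
      have vy: "y i = j" "y (Suc i) = Suc j"
        using xi ij by (simp_all add: y_eq fpf_conj_apply simple_apply)
      have "z = y" using fpf_conj_eq[OF ya(2) vy ij] a(4) by (simp add: z_eq)
      obtain c where c: "fpf_path n c y" "(c @ [i], c @ [j]) \<in> fpf_braid_equiv n"
        using fpf_shifted_arcs[OF ya(2) a(2) b(2) ij vy] by blast
      have "(a @ [i], c @ [i]) \<in> fpf_braid_equiv n" using app[OF a(1) c(1) _ a(2)] by simp
      also note c(2)
      also have "(c @ [j], b @ [j]) \<in> fpf_braid_equiv n"
        using app[OF c(1) b(1)[unfolded \<open>z = y\<close>] _ b(2)] len_eq[OF c(1) a(1)] by simp
      finally show ?thesis .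
    next
      case False
      define v where "v = fpf_conj j y"
      have v': "v = fpf_conj i z" unfolding v_def y_eq z_eq using fpf_conj_commute[OF ij] by simp
      have "y j = simple i (x j)" "y (Suc j) = simple i (x (Suc j))"
        using ij by (simp_all add: y_eq fpf_conj_apply simple_apply)
      then have e1: "y (Suc j) < y j" "y j \<noteq> Suc j"
        using dj False ij by (auto simp: simple_apply)
      have "z i = simple j (x i)" "z (Suc i) = simple j (x (Suc i))"
        using ij by (simp_all add: z_eq fpf_conj_apply simple_apply)
      moreover have "\<not> (x i = Suc j \<and> x (Suc i) = j)" using False xx(2) by metis
      ultimately have e2: "z (Suc i) < z i" "z i \<noteq> Suc i"
        using di ij by (auto simp: simple_apply)
      note f = fpf_descent[OF ya(2) b(2) e1, folded v_def]
      obtain c where c: "fpf_path n c v" using fpf_path_exists[OF f(1)] by blast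
      note cw = fpf_pathD(1)[OF c]
      have py: "fpf_path n (c @ [j]) y" using fpf_path_descent[OF ya(2) b(2) e1] c by (simp only: v_def)
      have pz: "fpf_path n (c @ [i]) z" using fpf_path_descent[OF zb(2) a(2) e2] c by (simp only: v')
      have "(a @ [i], (c @ [j]) @ [i]) \<in> fpf_braid_equiv n" using app[OF a(1) py _ a(2)] by simp
      also have "((c @ [j]) @ [i], (c @ [i]) @ [j]) \<in> fpf_braid_equiv n"
        using fpf_braid_equiv_comm[of c n "[]" j i] cw a(2) b(2) ij by simp
      also have "((c @ [i]) @ [j], b @ [j]) \<in> fpf_braid_equiv n"
        using app[OF pz b(1) _ b(2)] len_eq[OF pz b(1)] lab by simp
      finally show ?thesis .
    qed
  qed
qed

lemma fpf_paths_equiv: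
  assumes "fpf_path n a x" "fpf_path n b x"
  shows "(a, b) \<in> fpf_braid_equiv n"
  using assms
proof (induction "length a" arbitrary: a b x)
  case 0
  then show ?case using fpf_pathD(3)[OF 0(2)] fpf_pathD(3)[OF 0(3)]
    by (simp add: fpf_braid_equiv_refl)
next
  case (Suc m)
  have lb: "length b = Suc m" using Suc.hyps(2) fpf_pathD(3)[OF Suc.prems(1)] fpf_pathD(3)[OF Suc.prems(2)]
    by simp
  from Suc.prems(1) obtain a' i y where a: "a = a' @ [i]" "fpf_path n a' y" "i \<in> {1..<2 * n}"
    "y i < y (Suc i)" "x = fpf_conj i y"
    using Suc.hyps(2) by cases auto
  from Suc.prems(2) obtain b' j z where b: "b = b' @ [j]" "fpf_path n b' z" "j \<in> {1..<2 * n}"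
    "z j < z (Suc j)" "x = fpf_conj j z"
    using lb by cases auto
  have l: "length a' = m" "length b' = m" using Suc.hyps(2) lb a b by simp_all
  have IH: "(c, d) \<in> fpf_braid_equiv n"
    if "fpf_path n c v" "fpf_path n d v" "length c = m" for c d v
    using Suc.hyps(1) that by metis
  consider "i = j" | "i < j" | "j < i" by linarith
  then show ?case
  proof cases
    case 1
    then have "y = z" using a(5) b(5) by (metis fpf_conj_fpf_conj)
    then have "(a', b') \<in> fpf_braid_equiv n" using IH a(2) b(2) l by blast
    then show ?thesis using fpf_braid_equiv_append[of a' b' n "[i]"] a 1 b by simp
  next
    case 2
    show ?thesis unfolding a(1) b(1)
      by (rule fpf_path_equiv_step[OF IH a(2-5) b(2-5) 2]) (simp_all add: l)
  next
    case 3
    show ?thesis unfolding a(1) b(1)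
      by (rule fpf_path_equiv_step[OF IH b(2-5) a(2-5) 3, THEN fpf_braid_equiv_sym]) (simp_all add: l)
  qed
qed

theorem theorem7p2:
  fixes n :: nat and x :: "nat \<Rightarrow> nat"
  assumes "fpf_involution (2 * n) x"
  shows "inv_words (2 * n) (w_fpf n) x \<in> words (2 * n) // fpf_braid_equiv n"
proof -
  obtain a where a: "fpf_path n a x" using fpf_path_exists[OF assms] by blast
  \<comment> \<open>One path represents the class: all paths to \<open>x\<close> are equivalent to
    it, and whatever is equivalent to it is a path to \<open>x\<close>.\<close>
  have "inv_words (2 * n) (w_fpf n) x = fpf_braid_equiv n `` {a}"
    unfolding inv_words_fpf_path[OF assms] using fpf_paths_equiv[OF a] fpf_path_equiv[OF a] by blast
  then show ?thesis using fpf_pathD(1)[OF a] by (auto intro: quotientI)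
qed

end
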